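(* For each $\Delta^0_2$ random Turing degree $\mathbf{r}$ there exist a countably supported computable probability measure $\mu$ on $2^\omega$ and a sequence $R\in\mathbf{r}$ such that (i) $R$ is Martin-Löf random with respect to $\mu$, (ii) $R$ has Cantor-Bendixson rank $1$, and (iii) the support of $\mu$ is rank-faithful.
   Context: A Turing degree is a $\Delta^0_2$ random degree if it is $\Delta^0_2$ and contains a Martin-Löf random sequence (random with respect to the Lebesgue measure). A measure $\mu$ on $2^\omega$ is computable if $\sigma\mapsto\mu(\llbracket\sigma\rrbracket)$ is computable as a real-valued function; it is countably supported if there is a countable set $\{X_i\colon i\in\omega\}$ with $\mu(\{X_i\colon i\in\omega\})=1$. For computable $\mu$, a $\mu$-Martin-Löf test is a uniformly $\Sigma^0_1$ sequence of open sets $(\mathcal U_i)$ with $\mu(\mathcal U_i)\le 2^{-i}$; $X$ is random with respect to $\mu$ if $X\notin\bigcap_i\mathcal U_i$ for every such test. The support of $\mu$ is $\{X\colon \forall n\ \mu(\llbracket X\upharpoonright n\rrbracket)>0\}$. For a closed set $\mathcal P$, $D(\mathcal P)$ is the set of non-isolated points of $\mathcal P$, iterated transfinitely ($D^0=\mathcal P$, $D^{\beta+1}=D(D^\beta)$, intersections at limits). For a $\Pi^0_1$ class $\mathcal P$ and $X\in\mathcal P$, $\mathit{rk}_{\mathcal P}(X)$ is the least $\beta$ with $X\in D^\beta(\mathcal P)\setminus D^{\beta+1}(\mathcal P)$. $X$ is ranked if $\mathit{rk}_{\mathcal P}(X)$ is defined for some $\Pi^0_1$ class $\mathcal P$, and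 its Cantor-Bendixson rank $\mathit{rk}(X)$ is the least such value over all $\Pi^0_1$ classes. A $\Pi^0_1$ class $\mathcal P$ is rank-faithful if $\mathit{rk}(X)=\mathit{rk}_{\mathcal P}(X)$ for all ranked $X\in\mathcal P$. *)

theory Defs
  imports
    "HOL-Analysis.Analysis"
    "HOL-Probability.Probability"
    "HOL-Library.Nat_Bijection"
begin

section \<open>Relative computability\<close>

text \<open>
  Partial recursive functions relative to a set of total functions given as oracles, as unary functions on
  the natural numbers; several arguments are passed via Cantor pairing. With no oracles these are
  the partial recursive functions.
\<close>

inductive partrec_in :: "(nat \<Rightarrow> nat) set \<Rightarrow> (nat \<rightharpoonup> nat) \<Rightarrow> bool"
  for \<O> :: "(nat \<Rightarrow> nat) set"
where
  zero: "partrec_in \<O> (\<lambda>_. Some 0)"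
| succ: "partrec_in \<O> (\<lambda>n. Some (Suc n))"
| left: "partrec_in \<O> (\<lambda>n. Some (fst (prod_decode n)))"
| right: "partrec_in \<O> (\<lambda>n. Some (snd (prod_decode n)))"
| given: "g \<in> \<O> \<Longrightarrow> partrec_in \<O> (\<lambda>n. Some (g n))"
| pair: "partrec_in \<O> f \<Longrightarrow> partrec_in \<O> g \<Longrightarrow>
    partrec_in \<O> (\<lambda>n. Option.bind (f n) (\<lambda>a. Option.bind (g n) (\<lambda>b. Some (prod_encode (a, b)))))"
| comp: "partrec_in \<O> f \<Longrightarrow> partrec_in \<O> g \<Longrightarrow> partrec_in \<O> (\<lambda>n. Option.bind (g n) f)"
| prec: "partrec_in \<O> f \<Longrightarrow> partrec_in \<O> g \<Longrightarrow>
    partrec_in \<O> (\<lambda>n. case prod_decode n of (a, m) \<Rightarrow>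
      rec_nat (f a) (\<lambda>y v. Option.bind v (\<lambda>i. g (prod_encode (a, prod_encode (y, i))))) m)"
| mu: "partrec_in \<O> f \<Longrightarrow>
    partrec_in \<O> (\<lambda>a.
      if \<exists>n. f (prod_encode (a, n)) = Some 0 \<and> (\<forall>m<n. f (prod_encode (a, m)) \<noteq> None)
      then Some (LEAST n. f (prod_encode (a, n)) = Some 0)
      else None)"

definition computable :: "(nat \<Rightarrow> nat) \<Rightarrow> bool" where
  "computable f \<longleftrightarrow> partrec_in {} (\<lambda>n. Some (f n))"

definition decidable :: "nat set \<Rightarrow> bool" where
  "decidable A \<longleftrightarrow> computable (\<lambda>n. of_bool (n \<in> A))"

definition comp_enumerable :: "nat set \<Rightarrow> bool" where
  "comp_enumerable A \<longleftrightarrow> (\<exists>f. partrec_in {} f \<and> A = dom f)"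

section \<open>Turing degrees\<close>

type_synonym cantor = "nat \<Rightarrow> bool"

definition turing_le :: "cantor \<Rightarrow> cantor \<Rightarrow> bool" where
  "turing_le X Y \<longleftrightarrow> partrec_in {\<lambda>n. of_bool (Y n)} (\<lambda>n. Some (of_bool (X n)))"

definition turing_equiv :: "(cantor \<times> cantor) set" where
  "turing_equiv = {(X, Y). turing_le X Y \<and> turing_le Y X}"

definition turing_degrees :: "cantor set set" where
  "turing_degrees = UNIV // turing_equiv"

definition Sigma02 :: "cantor \<Rightarrow> bool" where
  "Sigma02 X \<longleftrightarrow> (\<exists>D. decidable D \<and>
     (\<forall>n. X n \<longleftrightarrow> (\<exists>a. \<forall>b. prod_encode (n, prod_encode (a, b)) \<in> D)))"

definition Delta02 :: "cantor \<Rightarrow> bool" where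
  "Delta02 X \<longleftrightarrow> Sigma02 X \<and> Sigma02 (\<lambda>n. \<not> X n)"

section \<open>Effectively open and closed classes\<close>

definition string_code :: "bool list \<Rightarrow> nat" where
  "string_code \<sigma> = list_encode (map of_bool \<sigma>)"

definition cylinder :: "bool list \<Rightarrow> cantor set" where
  "cylinder \<sigma> = {X. \<forall>i<length \<sigma>. X i = \<sigma> ! i}"

definition initial_segment :: "cantor \<Rightarrow> nat \<Rightarrow> bool list" where
  "initial_segment X n = map X [0..<n]"

definition uniformly_Sigma01 :: "(nat \<Rightarrow> cantor set) \<Rightarrow> bool" where
  "uniformly_Sigma01 U \<longleftrightarrow> (\<exists>W. comp_enumerable W \<and>
     (\<forall>i. U i = (\<Union>\<sigma>\<in>{\<sigma>. prod_encode (i, string_code \<sigma>) \<in> W}. cylinder \<sigma>)))"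

definition Pi01_class :: "cantor set \<Rightarrow> bool" where
  "Pi01_class P \<longleftrightarrow> (\<exists>W. comp_enumerable W \<and>
     P = - (\<Union>\<sigma>\<in>{\<sigma>. string_code \<sigma> \<in> W}. cylinder \<sigma>))"

section \<open>Measures on Cantor space and randomness\<close>

definition decode_rat :: "nat \<Rightarrow> rat" where
  "decode_rat k = (case prod_decode k of (a, b) \<Rightarrow> of_int (int_decode a) / of_nat (Suc b))"

definition computable_real_on_strings :: "(bool list \<Rightarrow> real) \<Rightarrow> bool" where
  "computable_real_on_strings f \<longleftrightarrow> (\<exists>q. computable q \<and>
     (\<forall>\<sigma> n. \<bar>f \<sigma> - of_rat (decode_rat (q (prod_encode (string_code \<sigma>, n))))\<bar> \<le> (1/2) ^ n))"

definition probability_measure :: "cantor measure \<Rightarrow> bool" where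
  "probability_measure \<mu> \<longleftrightarrow> prob_space \<mu> \<and> sets \<mu> = sets borel"

definition computable_measure :: "cantor measure \<Rightarrow> bool" where
  "computable_measure \<mu> \<longleftrightarrow> computable_real_on_strings (\<lambda>\<sigma>. measure \<mu> (cylinder \<sigma>))"

definition countably_supported :: "cantor measure \<Rightarrow> bool" where
  "countably_supported \<mu> \<longleftrightarrow> (\<exists>X :: nat \<Rightarrow> cantor. measure \<mu> (range X) = 1)"

definition measure_support :: "cantor measure \<Rightarrow> cantor set" where
  "measure_support \<mu> = {X. \<forall>n. measure \<mu> (cylinder (initial_segment X n)) > 0}"

definition martin_loef_test :: "cantor measure \<Rightarrow> (nat \<Rightarrow> cantor set) \<Rightarrow> bool" where
  "martin_loef_test \<mu> U \<longleftrightarrow> uniformly_Sigma01 U \<and> (\<forall>i. measure \<mu> (U i) \<le> (1/2) ^ i)"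

definition martin_loef_random :: "cantor measure \<Rightarrow> cantor \<Rightarrow> bool" where
  "martin_loef_random \<mu> X \<longleftrightarrow> (\<forall>U. martin_loef_test \<mu> U \<longrightarrow> X \<notin> (\<Inter>i. U i))"

definition lebesgue_cantor :: "cantor measure" where
  "lebesgue_cantor = Pi\<^sub>M UNIV (\<lambda>_. measure_pmf (bernoulli_pmf (1/2)))"

instance bool :: second_countable_topology
proof
  show "\<exists>B :: bool set set. countable B \<and> open = generate_topology B"
  proof (intro exI conjI)
    show "countable (UNIV :: bool set set)" by (rule countable_finite) simp
    show "open = generate_topology (UNIV :: bool set set)"
      by (auto simp: fun_eq_iff Topological_Spaces.open_discrete intro: generate_topology.Basis)
  qed
qed

lemma borel_bool: "sets (borel :: bool measure) = UNIV"
  by (auto intro!: borel_open Topological_Spaces.open_discrete)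

lemma probability_measure_lebesgue_cantor: "probability_measure lebesgue_cantor"
proof -
  interpret product_prob_space "\<lambda>_::nat. measure_pmf (bernoulli_pmf (1/2))" UNIV
    by standard
  have "sets lebesgue_cantor = sets (Pi\<^sub>M UNIV (\<lambda>_::nat. borel :: bool measure))"
    unfolding lebesgue_cantor_def by (intro sets_PiM_cong refl) (simp add: borel_bool)
  also have "\<dots> = sets borel"
    by (rule sets_PiM_equal_borel)
  finally show ?thesis
    unfolding probability_measure_def lebesgue_cantor_def using prob_space_axioms by blast
qed

lemma lebesgue_cantor_cylinder: "measure lebesgue_cantor (cylinder \<sigma>) = (1/2) ^ length \<sigma>"
proof -
  interpret product_prob_space "\<lambda>_::nat. measure_pmf (bernoulli_pmf (1/2))" UNIV
    by standard
  let ?M = "\<lambda>_::nat. measure_pmf (bernoulli_pmf (1/2))"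
  have "cylinder \<sigma> = prod_emb UNIV ?M {..<length \<sigma>} (Pi\<^sub>E {..<length \<sigma>} (\<lambda>i. {\<sigma> ! i}))"
    by (auto simp: cylinder_def prod_emb_def restrict_def PiE_iff extensional_def)
  then have "measure lebesgue_cantor (cylinder \<sigma>)
      = (\<Prod>i<length \<sigma>. measure (measure_pmf (bernoulli_pmf (1/2))) {\<sigma> ! i})"
    unfolding lebesgue_cantor_def by (simp only: ) (rule measure_PiM_emb; simp)
  also have "\<dots> = (\<Prod>i<length \<sigma>. 1/2)"
    by (intro prod.cong refl) (simp add: measure_pmf_single pmf_bernoulli_half)
  finally show ?thesis by simp
qed

definition Delta02_random_degree :: "cantor set \<Rightarrow> bool" where
  "Delta02_random_degree r \<longleftrightarrow> r \<in> turing_degrees \<and>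
     (\<exists>X\<in>r. Delta02 X) \<and> (\<exists>X\<in>r. martin_loef_random lebesgue_cantor X)"

section \<open>Countable ordinals\<close>

text \<open>
  The library's \<open>cardSuc natLeq\<close> is a well-order of type \<open>\<omega>\<^sub>1\<close>, so the elements of its field are
  the countable ordinals. Countable ordinals suffice as Cantor-Bendixson ranks: Cantor space is second
  countable, so the iterated derivatives of a closed set are constant from some countable stage on.
\<close>

lemma Card_order_omega1: "Card_order (cardSuc natLeq)"
  by (rule cardSuc_Card_order[OF natLeq_Card_order])

lemma infinite_Field_omega1: "infinite (Field (cardSuc natLeq))"
  using cardSuc_finite[OF natLeq_Card_order] by (simp add: Field_natLeq)

typedef omega1 = "Field (cardSuc natLeq)"
  using infinite_Field_omega1 by (metis ex_in_conv finite.emptyI)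

lemma Linear_order_omega1: "Linear_order (cardSuc natLeq)"
  using Card_order_omega1 by (simp add: card_order_on_def well_order_on_def)

lemma wf_omega1: "wf (cardSuc natLeq - Id)"
  using Card_order_omega1 by (simp add: card_order_on_def well_order_on_def)

instantiation omega1 :: wellorder
begin

definition less_eq_omega1 :: "omega1 \<Rightarrow> omega1 \<Rightarrow> bool" where
  "\<alpha> \<le> \<beta> \<longleftrightarrow> (Rep_omega1 \<alpha>, Rep_omega1 \<beta>) \<in> cardSuc natLeq"

definition less_omega1 :: "omega1 \<Rightarrow> omega1 \<Rightarrow> bool" where
  "(\<alpha> :: omega1) < \<beta> \<longleftrightarrow> \<alpha> \<le> \<beta> \<and> \<not> \<beta> \<le> \<alpha>"

instance
proof
  have refl: "refl_on (Field (cardSuc natLeq)) (cardSuc natLeq)"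
    and trans: "trans (cardSuc natLeq)" and antisym: "antisym (cardSuc natLeq)"
    and total: "total_on (Field (cardSuc natLeq)) (cardSuc natLeq)"
    using Linear_order_omega1
    by (auto simp: linear_order_on_def partial_order_on_def preorder_on_def)
  fix x y z :: omega1
  show "x < y \<longleftrightarrow> x \<le> y \<and> \<not> y \<le> x"
    by (rule less_omega1_def)
  show "x \<le> x"
    using refl Rep_omega1 by (auto simp: less_eq_omega1_def refl_on_def)
  show "x \<le> y \<Longrightarrow> y \<le> z \<Longrightarrow> x \<le> z"
    using trans by (auto simp: less_eq_omega1_def dest: transD)
  show "x \<le> y \<Longrightarrow> y \<le> x \<Longrightarrow> x = y"
    using antisym by (auto simp: less_eq_omega1_def Rep_omega1_inject dest: antisymD)
  show "x \<le> y \<or> y \<le> x"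
    using total refl Rep_omega1[of x] Rep_omega1[of y]
    by (cases "x = y") (auto simp: less_eq_omega1_def total_on_def refl_on_def Rep_omega1_inject)
next
  fix P :: "omega1 \<Rightarrow> bool" and a :: omega1
  assume step: "\<And>x. (\<And>y. y < x \<Longrightarrow> P y) \<Longrightarrow> P x"
  have "wf (inv_image (cardSuc natLeq - Id) Rep_omega1)"
    by (rule wf_inv_image[OF wf_omega1])
  then show "P a"
  proof (induction a rule: wf_induct_rule)
    case (less x)
    show ?case
    proof (rule step)
      fix y assume "y < x"
      then have "(y, x) \<in> inv_image (cardSuc natLeq - Id) Rep_omega1"
        by (auto simp: less_omega1_def less_eq_omega1_def Rep_omega1_inject)
      then show "P y" by (rule less)
    qed
  qed
qed

end

instance omega1 :: no_top
proof
  fix a :: omega1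
  obtain b where b: "b \<in> Field (cardSuc natLeq)" "Rep_omega1 a \<noteq> b" "(Rep_omega1 a, b) \<in> cardSuc natLeq"
    using infinite_Card_order_limit[OF Card_order_omega1 infinite_Field_omega1 Rep_omega1] by blast
  then have "a \<le> Abs_omega1 b" "a \<noteq> Abs_omega1 b"
    by (auto simp: less_eq_omega1_def Abs_omega1_inverse)
  then show "\<exists>b. a < b" by (metis order_le_imp_less_or_eq)
qed

definition osuc :: "omega1 \<Rightarrow> omega1" where
  "osuc \<beta> = (LEAST \<gamma>. \<beta> < \<gamma>)"

instantiation omega1 :: "{zero, one}"
begin

definition zero_omega1 :: omega1 where
  "0 = (LEAST \<beta> :: omega1. True)"

definition one_omega1 :: omega1 where
  "1 = osuc 0"

instance ..

end

lemma osuc_greater: "\<beta> < osuc \<beta>"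
  unfolding osuc_def using gt_ex by (rule LeastI_ex)

lemma less_osuc_iff: "\<beta> < osuc \<gamma> \<longleftrightarrow> \<beta> \<le> \<gamma>"
  unfolding osuc_def using not_less_Least[of \<beta> "\<lambda>\<delta>. \<gamma> < \<delta>"] osuc_greater[of \<gamma>]
  by (auto simp: osuc_def not_less intro: le_less_trans)

lemma osuc_inject: "osuc \<beta> = osuc \<gamma> \<longleftrightarrow> \<beta> = \<gamma>"
  by (metis less_osuc_iff order_antisym order_refl)

lemma zero_le_omega1: "(0 :: omega1) \<le> \<beta>"
  unfolding zero_omega1_def by (rule Least_le) simp

lemma osuc_neq_zero: "osuc \<beta> \<noteq> 0"
  using osuc_greater[of \<beta>] zero_le_omega1[of \<beta>] by auto

section \<open>Cantor-Bendixson rank\<close>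

definition derivative :: "cantor set \<Rightarrow> cantor set" where
  "derivative P = {X \<in> P. \<not> X isolated_in P}"

function iter_derivative :: "omega1 \<Rightarrow> cantor set \<Rightarrow> cantor set" where
  "iter_derivative \<beta> P =
     (if \<beta> = 0 then P
      else if \<exists>\<gamma>. \<beta> = osuc \<gamma> then derivative (iter_derivative (THE \<gamma>. \<beta> = osuc \<gamma>) P)
      else (\<Inter>\<gamma>\<in>{..<\<beta>}. iter_derivative \<gamma> P))"
  by pat_completeness auto
termination
proof (relation "inv_image {(\<beta>, \<gamma>). \<beta> < \<gamma>} fst")
  show "wf (inv_image {(\<beta> :: omega1, \<gamma>). \<beta> < \<gamma>} (fst :: omega1 \<times> cantor set \<Rightarrow> omega1))"
    by (intro wf_inv_image wf)
qed (auto simp: osuc_inject osuc_greater)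

declare iter_derivative.simps [simp del]

lemma iter_derivative_0: "iter_derivative 0 P = P"
  by (simp add: iter_derivative.simps)

lemma iter_derivative_osuc: "iter_derivative (osuc \<beta>) P = derivative (iter_derivative \<beta> P)"
  by (subst iter_derivative.simps) (simp add: osuc_neq_zero osuc_inject)

lemma iter_derivative_limit:
  "\<beta> \<noteq> 0 \<Longrightarrow> (\<And>\<gamma>. \<beta> \<noteq> osuc \<gamma>) \<Longrightarrow> iter_derivative \<beta> P = (\<Inter>\<gamma>\<in>{..<\<beta>}. iter_derivative \<gamma> P)"
  by (subst iter_derivative.simps) simp

text \<open>In both rank functions \<^term>\<open>None\<close> means that the rank is undefined.\<close>

definition cb_rank_in :: "cantor set \<Rightarrow> cantor \<Rightarrow> omega1 option" where
  "cb_rank_in P X =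
     (if \<exists>\<beta>. X \<in> iter_derivative \<beta> P - iter_derivative (osuc \<beta>) P
      then Some (LEAST \<beta>. X \<in> iter_derivative \<beta> P - iter_derivative (osuc \<beta>) P)
      else None)"

definition ranked :: "cantor \<Rightarrow> bool" where
  "ranked X \<longleftrightarrow> (\<exists>P. Pi01_class P \<and> X \<in> P \<and> cb_rank_in P X \<noteq> None)"

definition cb_rank :: "cantor \<Rightarrow> omega1 option" where
  "cb_rank X =
     (if ranked X
      then Some (LEAST \<beta>. \<exists>P. Pi01_class P \<and> X \<in> P \<and> cb_rank_in P X = Some \<beta>)
      else None)"

definition rank_faithful :: "cantor set \<Rightarrow> bool" where
  "rank_faithful P \<longleftrightarrow> Pi01_class P \<and> (\<forall>X\<in>P. ranked X \<longrightarrow> cb_rank X = cb_rank_in P X)"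

end

theory Submission
  imports Defs
begin

text \<open>
  Let \<open>A\<close> be a random member of the degree. Being computable from a \<open>\<Delta>\<^sup>0\<^sub>2\<close> set, it is the limit of a
  computable sequence \<open>a\<^sub>0, a\<^sub>1, \<dots>\<close>. Map \<open>X\<close> to the sequence that has its \<open>n\<close>-th one at the first
  new stage \<open>s\<close> at which \<open>a\<^sub>s\<close> agrees with \<open>X\<close> on the first \<open>n + 1\<close> bits, and zeros elsewhere. Only
  the image \<open>R\<close> of \<open>A\<close> has infinitely many ones, so the pushforward \<open>\<mu>\<close> of the uniform measure is
  concentrated on a countable set. The map is total computable, hence \<open>\<mu>\<close> is computable and
  \<open>R\<close> is \<open>\<mu>\<close>-random; \<open>A\<close> is recovered from the stages recorded in \<open>R\<close>. A sequence
  in the support with finitely many ones is isolated there, because after its last one it is determined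
  by a stage at which \<open>a\<^sub>s\<close> has settled on finitely many bits; \<open>R\<close> is a limit of such sequences. Finally
  \<open>R\<close> is isolated in no \<open>\<Pi>\<^sup>0\<^sub>1\<close> class, for otherwise \<open>{A}\<close> would be a \<open>\<Pi>\<^sup>0\<^sub>1\<close> class,
  which is impossible for random \<open>A\<close>.
\<close>

section \<open>Closure properties of relative computability\<close>

definition recursive_in :: "(nat \<Rightarrow> nat) set \<Rightarrow> (nat \<Rightarrow> nat) \<Rightarrow> bool" where
  "recursive_in \<O> f \<longleftrightarrow> partrec_in \<O> (\<lambda>n. Some (f n))"

definition decidable_in :: "(nat \<Rightarrow> nat) set \<Rightarrow> (nat \<Rightarrow> bool) \<Rightarrow> bool" where
  "decidable_in \<O> P \<longleftrightarrow> recursive_in \<O> (\<lambda>n. of_bool (P n))"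

abbreviation pfst :: "nat \<Rightarrow> nat" where "pfst n \<equiv> fst (prod_decode n)"
abbreviation psnd :: "nat \<Rightarrow> nat" where "psnd n \<equiv> snd (prod_decode n)"

text \<open>Each rule concerns a compound term in one variable, so that
  \<open>intro recursive_intros\<close> takes a defining term apart. Binary functions enter through
  \<open>pfst p\<close> and \<open>psnd p\<close>.\<close>

named_theorems recursive_intros

lemma recursive_in_comp:
  assumes "recursive_in \<O> f" "recursive_in \<O> g"
  shows "recursive_in \<O> (\<lambda>n. f (g n))"
  using partrec_in.comp[of \<O> "\<lambda>n. Some (f n)" "\<lambda>n. Some (g n)"] assms
  by (simp add: recursive_in_def)

lemma recursive_in_pair [recursive_intros]:
  assumes "recursive_in \<O> f" "recursive_in \<O> g"
  shows "recursive_in \<O> (\<lambda>n. prod_encode (f n, g n))"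
  using partrec_in.pair[of \<O> "\<lambda>n. Some (f n)" "\<lambda>n. Some (g n)"] assms
  by (simp add: recursive_in_def)

lemma recursive_in_comp2:
  assumes "recursive_in \<O> (\<lambda>p. F (pfst p) (psnd p))" "recursive_in \<O> f" "recursive_in \<O> g"
  shows "recursive_in \<O> (\<lambda>n. F (f n) (g n))"
  using recursive_in_comp[OF assms(1) recursive_in_pair[OF assms(2,3)]] by simp

lemma recursive_in_Suc [recursive_intros]:
  "recursive_in \<O> f \<Longrightarrow> recursive_in \<O> (\<lambda>n. Suc (f n))"
  by (rule recursive_in_comp[of _ Suc]) (auto simp: recursive_in_def partrec_in.succ)

lemma recursive_in_fst [recursive_intros]:
  "recursive_in \<O> f \<Longrightarrow> recursive_in \<O> (\<lambda>n. pfst (f n))"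
  by (rule recursive_in_comp[of _ pfst]) (auto simp: recursive_in_def partrec_in.left)

lemma recursive_in_snd [recursive_intros]:
  "recursive_in \<O> f \<Longrightarrow> recursive_in \<O> (\<lambda>n. psnd (f n))"
  by (rule recursive_in_comp[of _ psnd]) (auto simp: recursive_in_def partrec_in.right)

lemma recursive_in_const [recursive_intros]: "recursive_in \<O> (\<lambda>_. c)"
proof (induction c)
  case 0
  show ?case by (simp add: recursive_in_def partrec_in.zero)
qed (rule recursive_in_Suc)

lemma recursive_in_id [recursive_intros]: "recursive_in \<O> (\<lambda>n. n)"
proof -
  have "recursive_in \<O> (\<lambda>n. prod_encode (pfst n, psnd n))"
    by (intro recursive_in_pair) (auto simp: recursive_in_def partrec_in.left partrec_in.right)
  then show ?thesis by simp
qed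

lemma recursive_in_oracle: "g \<in> \<O> \<Longrightarrow> recursive_in \<O> g"
  by (simp add: recursive_in_def partrec_in.given)

text \<open>With total \<open>f\<close> and \<open>g\<close> the binds of \<open>prec\<close> never
  fail. The input \<open>n\<close> itself is passed as the parameter, which lets the step function
  depend on it.\<close>

lemma recursive_in_rec_nat [recursive_intros]:
  assumes f: "recursive_in \<O> f" and m: "recursive_in \<O> m"
    and g: "recursive_in \<O> (\<lambda>p. g (pfst p) (pfst (psnd p)) (psnd (psnd p)))"
  shows "recursive_in \<O> (\<lambda>n. rec_nat (f n) (g n) (m n))"
proof -
  have rec: "rec_nat (Some (f n)) (\<lambda>y v. Option.bind v (\<lambda>i. Some (g n y i))) k
      = Some (rec_nat (f n) (g n) k)" for n k
    by (induction k) auto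
  have "recursive_in \<O> (\<lambda>p. rec_nat (f (pfst p)) (g (pfst p)) (psnd p))"
    using partrec_in.prec[OF f[unfolded recursive_in_def] g[unfolded recursive_in_def]]
    by (simp add: recursive_in_def case_prod_unfold rec)
  from recursive_in_comp[OF this recursive_in_pair[OF recursive_in_id m]]
  show ?thesis by simp
qed

text \<open>\<open>mu\<close> looks for a zero, whereas a true predicate has the value 1; the
  recursion on \<open>of_bool\<close> swaps the truth values.\<close>

lemma partrec_in_search:
  assumes "decidable_in \<O> (\<lambda>p. Q (pfst p) (psnd p))"
  shows "partrec_in \<O> (\<lambda>n. if \<exists>k. Q n k then Some (LEAST k. Q n k) else None)"
proof -
  have "recursive_in \<O> (\<lambda>p. rec_nat 1 (\<lambda>_ _. 0) (of_bool (Q (pfst p) (psnd p))))"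
    by (intro recursive_intros assms[unfolded decidable_in_def])
  moreover have "rec_nat 1 (\<lambda>_ _. 0) (of_bool b) = (0 :: nat) \<longleftrightarrow> b" for b
    by (cases b) auto
  ultimately show ?thesis
    using partrec_in.mu[of \<O> "\<lambda>p. Some (rec_nat 1 (\<lambda>_ _. 0) (of_bool (Q (pfst p) (psnd p))))"]
    by (simp add: recursive_in_def cong: if_cong)
qed

lemma recursive_in_Least [recursive_intros]:
  assumes "decidable_in \<O> (\<lambda>p. Q (pfst p) (psnd p))" "\<And>n. \<exists>k. Q n k"
  shows "recursive_in \<O> (\<lambda>n. LEAST k. Q n k)"
  using partrec_in_search[OF assms(1)] assms(2) by (simp add: recursive_in_def)

section \<open>Arithmetic and decidable predicates\<close>

lemma recursive_in_add [recursive_intros]: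
  assumes "recursive_in \<O> f" "recursive_in \<O> g"
  shows "recursive_in \<O> (\<lambda>n. f n + g n)"
proof -
  have eq: "a + b = rec_nat a (\<lambda>_. Suc) b" for a b :: nat
    by (induction b) auto
  show ?thesis unfolding eq by (intro recursive_intros assms)
qed

lemma recursive_in_mult [recursive_intros]:
  assumes "recursive_in \<O> f" "recursive_in \<O> g"
  shows "recursive_in \<O> (\<lambda>n. f n * g n)"
proof -
  have eq: "a * b = rec_nat 0 (\<lambda>_ v. a + v) b" for a b :: nat
    by (induction b) auto
  show ?thesis unfolding eq by (intro recursive_intros assms recursive_in_comp[OF assms(1)])
qed

lemma recursive_in_power [recursive_intros]:
  assumes "recursive_in \<O> f" "recursive_in \<O> g"
  shows "recursive_in \<O> (\<lambda>n. f n ^ g n)"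
proof -
  have eq: "a ^ b = rec_nat 1 (\<lambda>_ v. a * v) b" for a b :: nat
    by (induction b) auto
  show ?thesis unfolding eq by (intro recursive_intros assms recursive_in_comp[OF assms(1)])
qed

lemma recursive_in_diff [recursive_intros]:
  assumes "recursive_in \<O> f" "recursive_in \<O> g"
  shows "recursive_in \<O> (\<lambda>n. f n - g n)"
proof -
  have pred: "a - Suc 0 = rec_nat 0 (\<lambda>y _. y) a" for a :: nat
    by (cases a) auto
  have eq: "a - b = rec_nat a (\<lambda>_ v. rec_nat 0 (\<lambda>y _. y) v) b" for a b :: nat
    unfolding pred[symmetric] by (induction b) auto
  show ?thesis unfolding eq by (intro recursive_intros assms)
qed

lemma recursive_in_of_bool [recursive_intros]:
  "decidable_in \<O> P \<Longrightarrow> recursive_in \<O> (\<lambda>n. of_bool (P n))"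
  by (simp add: decidable_in_def)

lemma recursive_in_if [recursive_intros]:
  assumes "decidable_in \<O> P" "recursive_in \<O> f" "recursive_in \<O> g"
  shows "recursive_in \<O> (\<lambda>n. if P n then f n else g n)"
proof -
  have eq: "(if P n then f n else g n) = of_bool (P n) * f n + (1 - of_bool (P n)) * g n" for n
    by simp
  show ?thesis unfolding eq by (intro recursive_intros assms)
qed

lemma decidable_in_comp:
  assumes "decidable_in \<O> P" "recursive_in \<O> f"
  shows "decidable_in \<O> (\<lambda>n. P (f n))"
  using recursive_in_comp[OF assms(1)[unfolded decidable_in_def] assms(2)]
  by (simp add: decidable_in_def)

lemma decidable_in_comp2:
  assumes "decidable_in \<O> (\<lambda>p. P (pfst p) (psnd p))" "recursive_in \<O> f" "recursive_in \<O> g"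
  shows "decidable_in \<O> (\<lambda>n. P (f n) (g n))"
  using decidable_in_comp[OF assms(1) recursive_in_pair[OF assms(2,3)]] by simp

lemma decidable_in_le [recursive_intros]:
  assumes "recursive_in \<O> f" "recursive_in \<O> g"
  shows "decidable_in \<O> (\<lambda>n. f n \<le> g n)"
proof -
  have eq: "of_bool (a \<le> b) = 1 - (a - b)" for a b :: nat by auto
  show ?thesis unfolding decidable_in_def eq by (intro recursive_intros assms)
qed

lemma decidable_in_not [recursive_intros]:
  assumes "decidable_in \<O> P"
  shows "decidable_in \<O> (\<lambda>n. \<not> P n)"
proof -
  have eq: "of_bool (\<not> b) = (1 :: nat) - of_bool b" for b by auto
  show ?thesis unfolding decidable_in_def eq by (intro recursive_intros assms)
qed

lemma decidable_in_conj [recursive_intros]: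
  assumes "decidable_in \<O> P" "decidable_in \<O> Q"
  shows "decidable_in \<O> (\<lambda>n. P n \<and> Q n)"
proof -
  have eq: "of_bool (b \<and> c) = (of_bool b * of_bool c :: nat)" for b c by auto
  show ?thesis unfolding decidable_in_def eq by (intro recursive_intros assms)
qed

lemma decidable_in_disj [recursive_intros]:
  assumes "decidable_in \<O> P" "decidable_in \<O> Q"
  shows "decidable_in \<O> (\<lambda>n. P n \<or> Q n)"
proof -
  have eq: "b \<or> c \<longleftrightarrow> \<not> (\<not> b \<and> \<not> c)" for b c by auto
  show ?thesis unfolding eq by (intro recursive_intros assms)
qed

lemma decidable_in_less [recursive_intros]:
  assumes "recursive_in \<O> f" "recursive_in \<O> g"
  shows "decidable_in \<O> (\<lambda>n. f n < g n)"
  unfolding not_le[symmetric] by (intro recursive_intros assms)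

lemma decidable_in_eq [recursive_intros]:
  assumes "recursive_in \<O> f" "recursive_in \<O> g"
  shows "decidable_in \<O> (\<lambda>n. f n = g n)"
  unfolding order_eq_iff by (intro recursive_intros assms)

lemma decidable_in_iff [recursive_intros]:
  assumes "decidable_in \<O> P" "decidable_in \<O> Q"
  shows "decidable_in \<O> (\<lambda>n. P n = Q n)"
proof -
  have eq: "P n = Q n \<longleftrightarrow> (P n \<and> Q n) \<or> (\<not> P n \<and> \<not> Q n)" for n by blast
  show ?thesis unfolding eq by (intro recursive_intros assms)
qed

text \<open>The search for a counterexample is stopped at the bound \<open>m n\<close> and therefore
  always ends; \<open>P n\<close> holds below the bound exactly if the search gets that far.\<close>

lemma decidable_in_all_less [recursive_intros]:
  assumes P: "decidable_in \<O> (\<lambda>p. P (pfst p) (psnd p))" and m: "recursive_in \<O> m"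
  shows "decidable_in \<O> (\<lambda>n. \<forall>k<m n. P n k)"
proof -
  have "(\<forall>k<m n. P n k) \<longleftrightarrow> m n \<le> (LEAST k. m n \<le> k \<or> \<not> P n k)" (is "?l = ?r") for n
  proof
    assume ?l
    have "m n \<le> (LEAST k. m n \<le> k \<or> \<not> P n k) \<or> \<not> P n (LEAST k. m n \<le> k \<or> \<not> P n k)"
      by (rule LeastI[of _ "m n"]) simp
    with \<open>?l\<close> show ?r by (meson not_less)
  next
    assume r: ?r
    show ?l
    proof (intro allI impI)
      fix k assume "k < m n"
      with r have "k < (LEAST k. m n \<le> k \<or> \<not> P n k)" by simp
      from not_less_Least[OF this] show "P n k" by simp
    qed
  qed
  then show ?thesis
    by (simp only:)
      (intro recursive_intros decidable_in_comp2[OF P] m recursive_in_comp[OF m], blast)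
qed

lemma decidable_in_all_le [recursive_intros]:
  assumes "decidable_in \<O> (\<lambda>p. P (pfst p) (psnd p))" "recursive_in \<O> m"
  shows "decidable_in \<O> (\<lambda>n. \<forall>k\<le>m n. P n k)"
  unfolding less_Suc_eq_le[symmetric] by (intro recursive_intros assms)

lemma decidable_in_ex_le [recursive_intros]:
  assumes "decidable_in \<O> (\<lambda>p. P (pfst p) (psnd p))" "recursive_in \<O> m"
  shows "decidable_in \<O> (\<lambda>n. \<exists>k\<le>m n. P n k)"
proof -
  have eq: "(\<exists>k\<le>m n. P n k) \<longleftrightarrow> \<not> (\<forall>k\<le>m n. \<not> P n k)" for n by blast
  show ?thesis unfolding eq by (intro recursive_intros assms)
qed

lemma recursive_in_sum [recursive_intros]:
  assumes f: "recursive_in \<O> (\<lambda>p. f (pfst p) (psnd p))" and m: "recursive_in \<O> m"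
  shows "recursive_in \<O> (\<lambda>n. \<Sum>k<m n. f n k)"
proof -
  have eq: "(\<Sum>k<b. f n k) = rec_nat 0 (\<lambda>k v. v + f n k) b" for n b
    by (induction b) auto
  show ?thesis unfolding eq by (intro recursive_intros recursive_in_comp2[OF f] m)
qed

lemma recursive_in_div [recursive_intros]:
  assumes f: "recursive_in \<O> f" and g: "recursive_in \<O> g"
  shows "recursive_in \<O> (\<lambda>n. f n div g n)"
proof -
  \<comment> \<open>The disjunct \<open>b = 0\<close> stops the search at \<open>0\<close>, the
    value of division by zero.\<close>
  have eq: "a div b = (LEAST q. a < Suc q * b \<or> b = 0)" for a b :: nat
  proof (cases "b = 0")
    case False
    then have "a < Suc q * b \<longleftrightarrow> a div b \<le> q" for q
      using div_less_iff_less_mult[of b a "Suc q"] by (simp only: less_Suc_eq_le)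
    with False show ?thesis by (auto simp del: mult_Suc intro!: Least_equality[symmetric])
  qed (simp add: Least_equality)
  have "\<exists>q. a < Suc q * b \<or> b = 0" for a b :: nat
    by (rule exI[of _ a]) (cases b, auto)
  then show ?thesis unfolding eq
    by (intro recursive_intros recursive_in_comp[OF f] recursive_in_comp[OF g])
qed

lemma recursive_in_mod [recursive_intros]:
  assumes "recursive_in \<O> f" "recursive_in \<O> g"
  shows "recursive_in \<O> (\<lambda>n. f n mod g n)"
  unfolding minus_mult_div_eq_mod[symmetric] by (intro recursive_intros assms)

text \<open>Each query to an oracle in \<open>\<O>\<close> is replaced by a computation relative to
  \<open>\<O>'\<close>.\<close>

lemma partrec_in_trans:
  assumes "partrec_in \<O> f" "\<And>g. g \<in> \<O> \<Longrightarrow> recursive_in \<O>' g"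
  shows "partrec_in \<O>' f"
  using assms(1)
proof induction
  case (given g)
  then show ?case using assms(2) by (simp add: recursive_in_def)
qed (rule partrec_in.intros; assumption)+

lemma recursive_in_mono: "recursive_in {} f \<Longrightarrow> recursive_in \<O> f"
  unfolding recursive_in_def by (rule partrec_in_trans) auto

lemma decidable_in_mono: "decidable_in {} P \<Longrightarrow> decidable_in \<O> P"
  unfolding decidable_in_def by (rule recursive_in_mono)


section \<open>Stagewise approximation of partial recursive functions\<close>

text \<open>
  The value \<open>0\<close> stands for ``not yet defined''. With limit computable oracles only the limit is
  correct; without oracles every defined value is correct, so no monotonicity in the stage is needed.
\<close>

definition stage_approximation :: "bool \<Rightarrow> (nat \<Rightarrow> nat \<Rightarrow> nat) \<Rightarrow> (nat \<rightharpoonup> nat) \<Rightarrow> bool" where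
  "stage_approximation sound F f \<longleftrightarrow> recursive_in {} (\<lambda>p. F (pfst p) (psnd p)) \<and>
     (\<forall>n v. f n = Some v \<longrightarrow> (\<forall>\<^sub>F s in sequentially. F n s = Suc v)) \<and>
     (sound \<longrightarrow> (\<forall>n s v. F n s = Suc v \<longrightarrow> f n = Some v))"

lemma stage_approximationD:
  assumes "stage_approximation sound F f"
  shows "recursive_in {} (\<lambda>p. F (pfst p) (psnd p))"
    and "f n = Some v \<Longrightarrow> \<forall>\<^sub>F s in sequentially. F n s = Suc v"
    and "sound \<Longrightarrow> F n s = Suc v \<Longrightarrow> f n = Some v"
  using assms unfolding stage_approximation_def by blast+

lemma stage_approximation_total:
  assumes "recursive_in {} g"
  shows "stage_approximation sound (\<lambda>n s. Suc (g n)) (\<lambda>n. Some (g n))"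
  unfolding stage_approximation_def
  by (auto intro!: recursive_intros recursive_in_comp[OF assms])

lemma stage_approximation_pair:
  assumes f: "stage_approximation sound F f" and g: "stage_approximation sound G g"
  shows "stage_approximation sound
    (\<lambda>n s. if F n s = 0 \<or> G n s = 0 then 0 else Suc (prod_encode (F n s - 1, G n s - 1)))
    (\<lambda>n. Option.bind (f n) (\<lambda>a. Option.bind (g n) (\<lambda>b. Some (prod_encode (a, b)))))"
  unfolding stage_approximation_def
proof (intro conjI allI impI)
  show "recursive_in {} (\<lambda>p. if F (pfst p) (psnd p) = 0 \<or> G (pfst p) (psnd p) = 0 then 0
      else Suc (prod_encode (F (pfst p) (psnd p) - 1, G (pfst p) (psnd p) - 1)))"
    by (intro recursive_intros stage_approximationD(1)[OF f] stage_approximationD(1)[OF g])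
next
  fix n v
  assume "Option.bind (f n) (\<lambda>a. Option.bind (g n) (\<lambda>b. Some (prod_encode (a, b)))) = Some v"
  then obtain a b where "f n = Some a" "g n = Some b" "v = prod_encode (a, b)"
    by (auto simp: Option.bind_eq_Some_conv)
  with stage_approximationD(2)[OF f, of n a] stage_approximationD(2)[OF g, of n b]
  show "\<forall>\<^sub>F s in sequentially. (if F n s = 0 \<or> G n s = 0 then 0
      else Suc (prod_encode (F n s - 1, G n s - 1))) = Suc v"
    by (auto elim: eventually_elim2)
next
  fix n s v
  assume "sound" and "(if F n s = 0 \<or> G n s = 0 then 0
      else Suc (prod_encode (F n s - 1, G n s - 1))) = Suc v"
  then have "F n s = Suc (F n s - 1)" "G n s = Suc (G n s - 1)"
    and v: "v = prod_encode (F n s - 1, G n s - 1)"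
    by (auto split: if_splits)
  with \<open>sound\<close> have "f n = Some (F n s - 1)" "g n = Some (G n s - 1)"
    using stage_approximationD(3)[OF f] stage_approximationD(3)[OF g] by blast+
  with v show "Option.bind (f n) (\<lambda>a. Option.bind (g n) (\<lambda>b. Some (prod_encode (a, b)))) = Some v"
    by simp
qed

text \<open>Both functions are run to the same stage: once the inner value has settled, the argument
  of the outer approximation no longer changes.\<close>

lemma stage_approximation_comp:
  assumes f: "stage_approximation sound F f" and g: "stage_approximation sound G g"
  shows "stage_approximation sound (\<lambda>n s. if G n s = 0 then 0 else F (G n s - 1) s)
    (\<lambda>n. Option.bind (g n) f)"
  unfolding stage_approximation_def
proof (intro conjI allI impI)
  show "recursive_in {} (\<lambda>p. if G (pfst p) (psnd p) = 0 then 0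
      else F (G (pfst p) (psnd p) - 1) (psnd p))"
    by (intro recursive_intros recursive_in_comp2[OF stage_approximationD(1)[OF f]]
        stage_approximationD(1)[OF g])
next
  fix n v assume "Option.bind (g n) f = Some v"
  then obtain a where "g n = Some a" "f a = Some v"
    by (auto simp: Option.bind_eq_Some_conv)
  with stage_approximationD(2)[OF g, of n a] stage_approximationD(2)[OF f, of a v]
  show "\<forall>\<^sub>F s in sequentially. (if G n s = 0 then 0 else F (G n s - 1) s) = Suc v"
    by (auto elim: eventually_elim2)
next
  fix n s v
  assume "sound" and *: "(if G n s = 0 then 0 else F (G n s - 1) s) = Suc v"
  then have "G n s = Suc (G n s - 1)" by (auto split: if_splits)
  with \<open>sound\<close> have "g n = Some (G n s - 1)" using stage_approximationD(3)[OF g] by blast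
  moreover from * \<open>sound\<close> have "f (G n s - 1) = Some v"
    by (auto split: if_splits intro: stage_approximationD(3)[OF f])
  ultimately show "Option.bind (g n) f = Some v" by simp
qed

text \<open>An undefined value \<open>0\<close> is passed on through the rest of the recursion, and
  only finitely many calls have to settle.\<close>

lemma stage_approximation_prec:
  assumes f: "stage_approximation sound F f" and g: "stage_approximation sound G g"
  shows "stage_approximation sound
    (\<lambda>n s. rec_nat (F (pfst n) s) (\<lambda>y v. if v = 0 then 0
       else G (prod_encode (pfst n, prod_encode (y, v - 1))) s) (psnd n))
    (\<lambda>n. case prod_decode n of (a, m) \<Rightarrow>
      rec_nat (f a) (\<lambda>y v. Option.bind v (\<lambda>i. g (prod_encode (a, prod_encode (y, i))))) m)"
    (is "stage_approximation _ ?F ?f")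
  unfolding stage_approximation_def
proof (intro conjI allI impI)
  show "recursive_in {} (\<lambda>p. ?F (pfst p) (psnd p))"
    by (intro recursive_intros recursive_in_comp2[OF stage_approximationD(1)[OF f]]
        recursive_in_comp2[OF stage_approximationD(1)[OF g]])
next
  fix n v assume "?f n = Some v"
  moreover have "rec_nat (f a) (\<lambda>y v. Option.bind v (\<lambda>i. g (prod_encode (a, prod_encode (y, i))))) m
      = Some v \<Longrightarrow> \<forall>\<^sub>F s in sequentially. rec_nat (F a s) (\<lambda>y v. if v = 0 then 0
       else G (prod_encode (a, prod_encode (y, v - 1))) s) m = Suc v" for a m
  proof (induction m arbitrary: v)
    case 0
    then show ?case using stage_approximationD(2)[OF f, of a v] by simp
  next
    case (Suc m)
    then obtain i where i: "rec_nat (f a)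
        (\<lambda>y v. Option.bind v (\<lambda>i. g (prod_encode (a, prod_encode (y, i))))) m = Some i"
      and gi: "g (prod_encode (a, prod_encode (m, i))) = Some v"
      by (auto simp: Option.bind_eq_Some_conv)
    from Suc.IH[OF i] stage_approximationD(2)[OF g gi] show ?case
      by eventually_elim simp
  qed
  ultimately show "\<forall>\<^sub>F s in sequentially. ?F n s = Suc v"
    by (auto simp: case_prod_unfold)
next
  fix n s v assume "sound" "?F n s = Suc v"
  moreover have "rec_nat (F a s) (\<lambda>y v. if v = 0 then 0
       else G (prod_encode (a, prod_encode (y, v - 1))) s) m = Suc v \<Longrightarrow>
     rec_nat (f a) (\<lambda>y v. Option.bind v (\<lambda>i. g (prod_encode (a, prod_encode (y, i))))) m = Some v"
    for a m
  proof (induction m arbitrary: v)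
    case 0
    then show ?case using stage_approximationD(3)[OF f \<open>sound\<close>] by simp
  next
    case (Suc m)
    define i where "i = rec_nat (F a s) (\<lambda>y v. if v = 0 then 0
       else G (prod_encode (a, prod_encode (y, v - 1))) s) m"
    have "i \<noteq> 0" and gi: "G (prod_encode (a, prod_encode (m, i - 1))) s = Suc v"
      using Suc.prems by (auto simp: i_def[symmetric] split: if_splits)
    then have "rec_nat (f a) (\<lambda>y v. Option.bind v (\<lambda>i. g (prod_encode (a, prod_encode (y, i))))) m
        = Some (i - 1)"
      by (intro Suc.IH) (simp add: i_def)
    moreover have "g (prod_encode (a, prod_encode (m, i - 1))) = Some v"
      by (rule stage_approximationD(3)[OF g \<open>sound\<close> gi])
    ultimately show ?case by simp
  qed
  ultimately show "?f n = Some v"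
    by (auto simp: case_prod_unfold)
qed

lemma stage_approximation_mu:
  assumes f: "stage_approximation sound F f"
  shows "\<exists>G. stage_approximation sound G
    (\<lambda>a. if \<exists>n. f (prod_encode (a, n)) = Some 0 \<and> (\<forall>m<n. f (prod_encode (a, m)) \<noteq> None)
      then Some (LEAST n. f (prod_encode (a, n)) = Some 0) else None)"
    (is "\<exists>G. stage_approximation _ G ?f")
proof -
  \<comment> \<open>A search bounded by \<open>s\<close>: \<open>k a s\<close> is the first argument
    not seen to have a positive value, where \<open>0\<close> means undefined and \<open>1\<close>
    means the value zero. Only the latter makes \<open>G\<close> answer.\<close>
  define k where "k a s = (LEAST k. s \<le> k \<or> F (prod_encode (a, k)) s \<le> 1)" for a s
  define G where "G a s = (if k a s < s \<and> F (prod_encode (a, k a s)) s = 1 then Suc (k a s) else 0)"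
    for a s
  have rec_k: "recursive_in {} (\<lambda>p. k (pfst p) (psnd p))"
    unfolding k_def
    by (intro recursive_intros recursive_in_comp2[OF stage_approximationD(1)[OF f]]) blast
  have "stage_approximation sound G ?f"
    unfolding stage_approximation_def
  proof (intro conjI allI impI)
    show "recursive_in {} (\<lambda>p. G (pfst p) (psnd p))"
      unfolding G_def
      by (intro recursive_intros recursive_in_comp2[OF stage_approximationD(1)[OF f]] rec_k)
  next
    fix a v assume v: "?f a = Some v"
    then obtain n where n: "f (prod_encode (a, n)) = Some 0"
      "\<forall>m<n. f (prod_encode (a, m)) \<noteq> None"
      by (auto split: if_splits)
    from v have v_def: "v = (LEAST n. f (prod_encode (a, n)) = Some 0)"
      by (auto split: if_splits)
    have fv: "f (prod_encode (a, v)) = Some 0" unfolding v_def by (rule LeastI[of _ n]) (rule n)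
    have "v \<le> n" unfolding v_def by (rule Least_le) (rule n)
    have less: "\<exists>w. f (prod_encode (a, m)) = Some (Suc w)" if "m < v" for m
      using that n(2) \<open>v \<le> n\<close> not_less_Least[of m "\<lambda>n. f (prod_encode (a, n)) = Some 0"]
      by (metis less_le_trans not0_implies_Suc not_Some_eq v_def)
    have "\<forall>\<^sub>F s in sequentially. \<forall>m\<in>{..<v}. 1 < F (prod_encode (a, m)) s"
    proof (rule eventually_ball_finite[OF finite_lessThan], intro ballI)
      fix m assume "m \<in> {..<v}"
      with less obtain w where "f (prod_encode (a, m)) = Some (Suc w)" by auto
      from stage_approximationD(2)[OF f this]
      show "\<forall>\<^sub>F s in sequentially. 1 < F (prod_encode (a, m)) s"
        by eventually_elim simp
    qed
    moreover note stage_approximationD(2)[OF f fv] eventually_gt_at_top[of v]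
    ultimately show "\<forall>\<^sub>F s in sequentially. G a s = Suc v"
    proof eventually_elim
      case (elim s)
      have "k a s = v"
        unfolding k_def
      proof (rule Least_equality)
        fix m assume "s \<le> m \<or> F (prod_encode (a, m)) s \<le> 1"
        with elim show "v \<le> m" by (metis lessThan_iff less_trans not_le)
      qed (use elim in simp)
      with elim show ?case by (simp add: G_def)
    qed
  next
    fix a s v assume sound and "G a s = Suc v"
    then have v: "k a s = v" "v < s" "F (prod_encode (a, v)) s = Suc 0"
      by (auto simp: G_def split: if_splits)
    from stage_approximationD(3)[OF f \<open>sound\<close> v(3)] have fv: "f (prod_encode (a, v)) = Some 0" .
    have less: "\<exists>w. f (prod_encode (a, m)) = Some (Suc w)" if "m < v" for m
    proof -
      from that v(1) have "m < (LEAST k. s \<le> k \<or> F (prod_encode (a, k)) s \<le> 1)"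
        by (simp add: k_def)
      \<comment> \<open>Below \<open>v\<close> all stage values exceed \<open>1\<close>, so by
        soundness \<open>f\<close> is defined there with positive values.\<close>
      from not_less_Least[OF this] have "F (prod_encode (a, m)) s = Suc (Suc (F (prod_encode (a, m)) s - 2))"
        by linarith
      from stage_approximationD(3)[OF f \<open>sound\<close> this] show ?thesis by blast
    qed
    have "(LEAST n. f (prod_encode (a, n)) = Some 0) = v"
    proof (rule Least_equality)
      fix m assume "f (prod_encode (a, m)) = Some 0"
      with less show "v \<le> m" by (metis not_le option.inject nat.distinct(1))
    qed (rule fv)
    moreover have "\<exists>n. f (prod_encode (a, n)) = Some 0 \<and> (\<forall>m<n. f (prod_encode (a, m)) \<noteq> None)"
      using fv less by (metis option.distinct(1))
    ultimately show "?f a = Some v" by simp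
  qed
  then show ?thesis by blast
qed

text \<open>Induction on the derivation of \<open>f\<close>. With limit computable oracles early
  stages may work with wrong answers, so soundness is claimed only for an empty oracle set.\<close>

lemma ex_stage_approximation:
  assumes "partrec_in \<O> f"
    and "\<And>g. g \<in> \<O> \<Longrightarrow> \<exists>G. recursive_in {} (\<lambda>p. G (pfst p) (psnd p)) \<and>
      (\<forall>n. \<forall>\<^sub>F s in sequentially. G n s = g n)"
  shows "\<exists>F. stage_approximation (\<O> = {}) F f"
  using assms(1)
proof induction
  case (given g)
  with assms(2) obtain G where G: "recursive_in {} (\<lambda>p. G (pfst p) (psnd p))"
    "\<And>n. \<forall>\<^sub>F s in sequentially. G n s = g n"
    by blast
  have "stage_approximation (\<O> = {}) (\<lambda>n s. Suc (G n s)) (\<lambda>n. Some (g n))"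
    unfolding stage_approximation_def using given G by (auto intro: recursive_intros)
  then show ?case by blast
next
  case (mu f)
  then show ?case using stage_approximation_mu by blast
next
  case (pair f g)
  then show ?case by - (elim exE, intro exI, rule stage_approximation_pair; assumption)
next
  case (comp f g)
  then show ?case by - (elim exE, intro exI, rule stage_approximation_comp; assumption)
next
  case (prec f g)
  then show ?case by - (elim exE, intro exI, rule stage_approximation_prec; assumption)
qed (rule exI, rule stage_approximation_total, intro recursive_intros)+

section \<open>Enumerable sets and limit computability\<close>

lemma comp_enumerable_iff_projection:
  "comp_enumerable W \<longleftrightarrow>
    (\<exists>Q. decidable_in {} (\<lambda>p. Q (pfst p) (psnd p)) \<and> W = {n. \<exists>s. Q n s})"
proof
  assume "comp_enumerable W"
  then obtain f where f: "partrec_in {} f" "W = dom f"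
    unfolding comp_enumerable_def by blast
  then obtain F where F: "stage_approximation True F f"
    using ex_stage_approximation[of "{}" f] by auto
  \<comment> \<open>Eventual correctness yields a stage for each element of the domain; by soundness
    no other \<open>n\<close> ever gets a nonzero value.\<close>
  have "n \<in> dom f \<longleftrightarrow> (\<exists>s. F n s \<noteq> 0)" for n
  proof
    assume "n \<in> dom f"
    then obtain v where "f n = Some v" by blast
    from stage_approximationD(2)[OF F this] obtain s where "F n s = Suc v"
      using eventually_happens'[OF sequentially_bot] by blast
    then show "\<exists>s. F n s \<noteq> 0" by (metis nat.distinct(1))
  next
    assume "\<exists>s. F n s \<noteq> 0"
    then obtain s v where "F n s = Suc v" using not0_implies_Suc by blast
    with stage_approximationD(3)[OF F] show "n \<in> dom f" by blast
  qed
  moreover have "decidable_in {} (\<lambda>p. F (pfst p) (psnd p) \<noteq> 0)"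
    by (intro recursive_intros stage_approximationD(1)[OF F])
  ultimately show "\<exists>Q. decidable_in {} (\<lambda>p. Q (pfst p) (psnd p)) \<and> W = {n. \<exists>s. Q n s}"
    using f(2) by (intro exI[of _ "\<lambda>n s. F n s \<noteq> 0"]) auto
next
  assume "\<exists>Q. decidable_in {} (\<lambda>p. Q (pfst p) (psnd p)) \<and> W = {n. \<exists>s. Q n s}"
  then obtain Q where "decidable_in {} (\<lambda>p. Q (pfst p) (psnd p))" and W: "W = {n. \<exists>s. Q n s}"
    by blast
  then have "partrec_in {} (\<lambda>n. if \<exists>k. Q n k then Some (LEAST k. Q n k) else None)"
    by (intro partrec_in_search)
  moreover have "W = dom (\<lambda>n. if \<exists>k. Q n k then Some (LEAST k. Q n k) else None)"
    unfolding W by (auto simp: dom_def)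
  ultimately show "comp_enumerable W" unfolding comp_enumerable_def by blast
qed

lemma comp_enumerable_vimage:
  assumes "comp_enumerable W" "recursive_in {} f"
  shows "comp_enumerable (f -` W)"
proof -
  from assms(1) obtain g where "partrec_in {} g" and W: "W = dom g"
    unfolding comp_enumerable_def by blast
  then have "partrec_in {} (\<lambda>n. Option.bind (Some (f n)) g)"
    using assms(2) unfolding recursive_in_def by (intro partrec_in.comp)
  moreover have "f -` W = dom (\<lambda>n. Option.bind (Some (f n)) g)"
    unfolding W by auto
  ultimately show ?thesis unfolding comp_enumerable_def by blast
qed

lemma turing_le_trans: "turing_le X Y \<Longrightarrow> turing_le Y Z \<Longrightarrow> turing_le X Z"
  unfolding turing_le_def by (erule partrec_in_trans) (simp add: recursive_in_def)

text \<open>One half of Shoenfield's limit lemma. Witnesses for \<open>Y n\<close> and for its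
  negation compete: stage \<open>s\<close> picks the least \<open>a\<close> not refuted on both
  sides by some \<open>b \<le> s\<close> and answers whether \<open>a\<close> still looks like a
  witness for \<open>Y n\<close>. The search is cut off at \<open>s\<close>.\<close>

lemma Delta02_limit:
  assumes "Delta02 Y"
  shows "\<exists>G. decidable_in {} (\<lambda>p. G (pfst p) (psnd p)) \<and> (\<forall>n. \<forall>\<^sub>F s in sequentially. G n s = Y n)"
proof -
  from assms obtain D E where "decidable D" "decidable E"
    and Y: "\<And>n. Y n \<longleftrightarrow> (\<exists>a. \<forall>b. prod_encode (n, prod_encode (a, b)) \<in> D)"
    and nY: "\<And>n. \<not> Y n \<longleftrightarrow> (\<exists>a. \<forall>b. prod_encode (n, prod_encode (a, b)) \<in> E)"
    unfolding Delta02_def Sigma02_def by metis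
  then have D: "decidable_in {} (\<lambda>n. n \<in> D)" and E: "decidable_in {} (\<lambda>n. n \<in> E)"
    by (simp_all add: decidable_def computable_def decidable_in_def recursive_in_def)
  define P where "P n s a \<longleftrightarrow> (\<forall>b\<le>s. prod_encode (n, prod_encode (a, b)) \<in> D)" for n s a
  define Q where "Q n s a \<longleftrightarrow> (\<forall>b\<le>s. prod_encode (n, prod_encode (a, b)) \<in> E)" for n s a
  define k where "k n s = (LEAST a. s \<le> a \<or> P n s a \<or> Q n s a)" for n s
  have P: "decidable_in {} (\<lambda>p. P (f p) (g p) (h p))"
    if "recursive_in {} f" "recursive_in {} g" "recursive_in {} h" for f g h
    unfolding P_def
    by (intro recursive_intros decidable_in_comp[OF D] that that[THEN recursive_in_comp])
  have Q: "decidable_in {} (\<lambda>p. Q (f p) (g p) (h p))"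
    if "recursive_in {} f" "recursive_in {} g" "recursive_in {} h" for f g h
    unfolding Q_def
    by (intro recursive_intros decidable_in_comp[OF E] that that[THEN recursive_in_comp])
  have "recursive_in {} (\<lambda>p. k (pfst p) (psnd p))"
    unfolding k_def by (intro recursive_intros P Q) blast
  then have "decidable_in {} (\<lambda>p. P (pfst p) (psnd p) (k (pfst p) (psnd p)))"
    by (intro P recursive_intros)
  moreover have "\<forall>\<^sub>F s in sequentially. P n s (k n s) = Y n" for n
  proof -
    define P' where "P' a \<longleftrightarrow> (\<forall>b. prod_encode (n, prod_encode (a, b)) \<in> D)" for a
    define Q' where "Q' a \<longleftrightarrow> (\<forall>b. prod_encode (n, prod_encode (a, b)) \<in> E)" for a
    \<comment> \<open>The least true witness for either side; all smaller candidates are refuted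
      from some stage on, so \<open>k n s\<close> settles at \<open>c\<close>.\<close>
    define c where "c = (LEAST a. P' a \<or> Q' a)"
    have c: "P' c \<or> Q' c"
      unfolding c_def by (rule LeastI_ex) (use Y[of n] nY[of n] in \<open>unfold P'_def Q'_def, blast\<close>)
    have fail: "\<forall>\<^sub>F s in sequentially. \<not> P n s a" if "\<not> P' a" for a
    proof -
      from that obtain b where "prod_encode (n, prod_encode (a, b)) \<notin> D" by (auto simp: P'_def)
      then show ?thesis
        by (auto simp: P_def intro!: eventually_mono[OF eventually_ge_at_top[of b]])
    qed
    have fail': "\<forall>\<^sub>F s in sequentially. \<not> Q n s a" if "\<not> Q' a" for a
    proof -
      from that obtain b where "prod_encode (n, prod_encode (a, b)) \<notin> E" by (auto simp: Q'_def)
      then show ?thesis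
        by (auto simp: Q_def intro!: eventually_mono[OF eventually_ge_at_top[of b]])
    qed
    have "\<forall>\<^sub>F s in sequentially. \<forall>a\<in>{..<c}. \<not> P n s a \<and> \<not> Q n s a"
    proof (rule eventually_ball_finite[OF finite_lessThan], intro ballI)
      fix a assume "a \<in> {..<c}"
      then have "\<not> P' a \<and> \<not> Q' a"
        using not_less_Least[of a "\<lambda>a. P' a \<or> Q' a"] by (simp add: c_def)
      then show "\<forall>\<^sub>F s in sequentially. \<not> P n s a \<and> \<not> Q n s a"
        using fail fail' eventually_conj by blast
    qed
    then have "\<forall>\<^sub>F s in sequentially. k n s = c"
      using eventually_gt_at_top[of c]
    proof eventually_elim
      case (elim s)
      show ?case unfolding k_def
      proof (rule Least_equality)
        show "s \<le> c \<or> P n s c \<or> Q n s c" using c by (auto simp: P_def Q_def P'_def Q'_def)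
      next
        fix a assume "s \<le> a \<or> P n s a \<or> Q n s a"
        with elim show "c \<le> a" by (metis lessThan_iff less_trans not_le)
      qed
    qed
    moreover have "\<forall>\<^sub>F s in sequentially. P n s c = Y n"
    proof (cases "P' c")
      case True
      then have "Y n" by (auto simp: Y P'_def)
      with True show ?thesis by (auto simp: P_def P'_def)
    next
      case False
      with c have "Q' c" by blast
      then have "\<not> Y n" by (auto simp: nY Q'_def)
      with fail[OF False] show ?thesis by simp
    qed
    ultimately show ?thesis by eventually_elim simp
  qed
  ultimately show ?thesis by (intro exI[of _ "\<lambda>n s. P n s (k n s)"]) simp
qed

text \<open>The reduction is run with the stagewise approximation of \<open>Y\<close> as its
  oracle.\<close>

lemma turing_le_Delta02_limit:
  assumes "turing_le X Y" "Delta02 Y"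
  shows "\<exists>G. decidable_in {} (\<lambda>p. G (pfst p) (psnd p)) \<and> (\<forall>n. \<forall>\<^sub>F s in sequentially. G n s = X n)"
proof -
  from Delta02_limit[OF assms(2)] obtain G where G: "decidable_in {} (\<lambda>p. G (pfst p) (psnd p))"
    "\<And>n. \<forall>\<^sub>F s in sequentially. G n s = Y n"
    by blast
  have "\<exists>F. stage_approximation (({\<lambda>n. of_bool (Y n)} :: (nat \<Rightarrow> nat) set) = {}) F (\<lambda>n. Some (of_bool (X n)))"
    using assms(1) unfolding turing_le_def
  proof (rule ex_stage_approximation)
    fix g :: "nat \<Rightarrow> nat" assume "g \<in> {\<lambda>n. of_bool (Y n)}"
    moreover have "\<forall>\<^sub>F s in sequentially. of_bool (G n s) = (of_bool (Y n) :: nat)" for n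
      using G(2)[of n] by eventually_elim simp
    ultimately show "\<exists>G. recursive_in {} (\<lambda>p. G (pfst p) (psnd p)) \<and>
        (\<forall>n. \<forall>\<^sub>F s in sequentially. G n s = g n)"
      by (intro exI[of _ "\<lambda>n s. of_bool (G n s)"])
        (auto intro: recursive_intros G(1))
  qed
  then obtain F where F: "stage_approximation False F (\<lambda>n. Some (of_bool (X n)))" by auto
  have "\<forall>\<^sub>F s in sequentially. (F n s = 2) = X n" for n
    using stage_approximationD(2)[OF F refl, of n] by eventually_elim auto
  \<comment> \<open>The number \<open>2\<close> is \<open>Suc (of_bool True)\<close>, the stage
    value standing for a defined true bit.\<close>
  moreover have "decidable_in {} (\<lambda>p. F (pfst p) (psnd p) = 2)"
    by (intro recursive_intros stage_approximationD(1)[OF F])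
  ultimately show ?thesis by (intro exI[of _ "\<lambda>n s. F n s = 2"]) simp
qed


section \<open>Codes of strings\<close>

text \<open>A nonempty list has a code of the form \<open>Suc (prod_encode (x, c))\<close> with
  \<open>c\<close> the code of its tail, so one step passes to the tail. The empty list, coded by
  \<open>0\<close>, is kept because \<open>psnd 0 = 0\<close>.\<close>

definition code_drop :: "nat \<Rightarrow> nat \<Rightarrow> nat" where
  "code_drop c i = rec_nat c (\<lambda>_ v. psnd (v - 1)) i"

definition code_nth :: "nat \<Rightarrow> nat \<Rightarrow> nat" where
  "code_nth c i = pfst (code_drop c i - 1)"

text \<open>Counts the nonempty suffixes; the bound \<open>c\<close> suffices because the code of a
  list is at least its length.\<close>

definition code_length :: "nat \<Rightarrow> nat" where
  "code_length c = (\<Sum>i<c. of_bool (code_drop c i \<noteq> 0))"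

lemma code_drop_list_encode: "code_drop (list_encode xs) i = list_encode (drop i xs)"
proof (induction i)
  case (Suc i)
  have "psnd 0 = 0"
    by (simp add: prod_decode_def prod_decode_aux.simps)
  then have "psnd (list_encode ys - 1) = list_encode (tl ys)" for ys
    by (cases ys) auto
  with Suc show ?case by (simp add: code_drop_def drop_Suc drop_tl)
qed (simp add: code_drop_def)

lemma code_nth_list_encode: "i < length xs \<Longrightarrow> code_nth (list_encode xs) i = xs ! i"
  by (simp add: code_nth_def code_drop_list_encode flip: Cons_nth_drop_Suc)

lemma code_length_list_encode: "code_length (list_encode xs) = length xs"
proof -
  have "length xs \<le> list_encode xs"
    by (induction xs) (auto intro: order_trans[OF _ le_prod_encode_2])
  moreover have "list_encode ys = 0 \<longleftrightarrow> ys = []" for ys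
    by (cases ys) auto
  ultimately have "{..<list_encode xs} \<inter> {i. list_encode (drop i xs) \<noteq> 0} = {..<length xs}"
    by (intro set_eqI) (simp, linarith)
  then show ?thesis
    by (simp only: code_length_def code_drop_list_encode of_bool_def sum.If_cases finite_lessThan) simp
qed

lemma recursive_in_code_nth [recursive_intros]:
  assumes "recursive_in \<O> f" "recursive_in \<O> g"
  shows "recursive_in \<O> (\<lambda>n. code_nth (f n) (g n))"
  unfolding code_nth_def code_drop_def by (intro recursive_intros assms)

lemma recursive_in_code_length [recursive_intros]:
  assumes "recursive_in \<O> f"
  shows "recursive_in \<O> (\<lambda>n. code_length (f n))"
  unfolding code_length_def code_drop_def
  by (intro recursive_intros recursive_in_comp[OF assms] assms)

lemma recursive_in_list_encode_map [recursive_intros]: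
  assumes g: "recursive_in \<O> (\<lambda>p. g (pfst p) (psnd p))" and m: "recursive_in \<O> m"
  shows "recursive_in \<O> (\<lambda>n. list_encode (map (g n) [0..<m n]))"
proof -
  \<comment> \<open>Codes of lists grow at the front, so the recursion runs from the last entry
    backwards.\<close>
  have "j \<le> k \<Longrightarrow> list_encode (map (g n) [k - j..<k]) =
      rec_nat 0 (\<lambda>j v. Suc (prod_encode (g n (k - Suc j), v))) j" for n j k
  proof (induction j)
    case (Suc j)
    then have "[k - Suc j..<k] = (k - Suc j) # [k - j..<k]"
      by (subst upt_conv_Cons) (auto simp: Suc_diff_Suc)
    with Suc show ?case by simp
  qed simp
  from this[OF order_refl] have eq: "list_encode (map (g n) [0..<k]) =
      rec_nat 0 (\<lambda>j v. Suc (prod_encode (g n (k - Suc j), v))) k" for n k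
    by simp
  show ?thesis
    unfolding eq by (intro recursive_intros recursive_in_comp2[OF g] m recursive_in_comp[OF m])
qed

text \<open>Turns a code into a point of Cantor space, so that functionals on sequences can be
  applied to strings.\<close>

definition decoded_string :: "nat \<Rightarrow> cantor" where
  "decoded_string c i \<longleftrightarrow> code_nth c i = 1"

lemma decoded_string_code: "i < length \<sigma> \<Longrightarrow> decoded_string (string_code \<sigma>) i = \<sigma> ! i"
  by (simp add: decoded_string_def string_code_def code_nth_list_encode)

lemma code_length_string_code [simp]: "code_length (string_code \<sigma>) = length \<sigma>"
  by (simp add: string_code_def code_length_list_encode)

lemma string_code_eq_iff [simp]: "string_code \<sigma> = string_code \<tau> \<longleftrightarrow> \<sigma> = \<tau>"
  by (auto simp: string_code_def list_encode_eq inj_map_eq_map inj_on_def)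

lemma decidable_in_decoded_string [recursive_intros]:
  assumes "recursive_in \<O> f" "recursive_in \<O> g"
  shows "decidable_in \<O> (\<lambda>n. decoded_string (f n) (g n))"
  unfolding decoded_string_def by (intro recursive_intros assms)

lemma recursive_in_string_code [recursive_intros]:
  assumes "decidable_in \<O> (\<lambda>p. X (pfst p) (psnd p))" "recursive_in \<O> m"
  shows "recursive_in \<O> (\<lambda>n. string_code (initial_segment (X n) (m n)))"
  unfolding string_code_def initial_segment_def map_map o_def
  by (intro recursive_intros assms)

lemma length_initial_segment [simp]: "length (initial_segment X n) = n"
  by (simp add: initial_segment_def)

lemma initial_segment_eq_iff:
  "initial_segment X n = initial_segment Y n \<longleftrightarrow> (\<forall>i<n. X i = Y i)"
  by (auto simp: initial_segment_def)

lemma initial_segment_le: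
  "initial_segment X n = initial_segment Y n \<Longrightarrow> m \<le> n \<Longrightarrow>
    initial_segment X m = initial_segment Y m"
  by (simp add: initial_segment_eq_iff)

lemma in_cylinder_iff: "X \<in> cylinder \<sigma> \<longleftrightarrow> initial_segment X (length \<sigma>) = \<sigma>"
  unfolding cylinder_def initial_segment_def by (subst list_eq_iff_nth_eq) simp

lemma initial_segment_decoded_string [simp]:
  "initial_segment (decoded_string (string_code \<sigma>)) (length \<sigma>) = \<sigma>"
  by (rule nth_equalityI) (simp_all add: initial_segment_def decoded_string_code)

lemma finite_bool_lists_length_eq: "finite {\<sigma> :: bool list. length \<sigma> = n}"
  using finite_lists_length_eq[of "UNIV :: bool set"] by simp

section \<open>Enumeration of the strings of a given length\<close>

definition binary_digits :: "nat \<Rightarrow> cantor" where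
  "binary_digits k i \<longleftrightarrow> (k div 2 ^ i) mod 2 = 1"

lemma decidable_in_binary_digits [recursive_intros]:
  assumes "recursive_in \<O> f" "recursive_in \<O> g"
  shows "decidable_in \<O> (\<lambda>n. binary_digits (f n) (g n))"
  unfolding binary_digits_def by (intro recursive_intros assms)

text \<open>Surjectivity is by induction on the string, lowest digit first; injectivity follows by
  counting. Quantifiers and sums over strings thus become bounded ones over numbers.\<close>

lemma bij_betw_binary_digits:
  "bij_betw (\<lambda>k. initial_segment (binary_digits k) n) {..<2 ^ n} {\<sigma>. length \<sigma> = n}"
proof -
  have surj: "\<exists>k<2 ^ length \<sigma>. initial_segment (binary_digits k) (length \<sigma>) = \<sigma>" for \<sigma>
  proof (induction \<sigma>)
    case (Cons b \<sigma>)
    then obtain k where k: "k < 2 ^ length \<sigma>"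
      and seg: "initial_segment (binary_digits k) (length \<sigma>) = \<sigma>" by blast
    let ?k = "2 * k + of_bool b"
    have "binary_digits ?k 0 = b"
      by (simp add: binary_digits_def)
    moreover have "binary_digits ?k (Suc i) = binary_digits k i" for i
      by (simp add: binary_digits_def div_mult2_eq)
    ultimately have "initial_segment (binary_digits ?k) (length (b # \<sigma>)) = b # \<sigma>"
      using seg unfolding initial_segment_def list.size add_Suc_right add_0_right map_upt_Suc by simp
    moreover have "?k < 2 ^ length (b # \<sigma>)" using k by (cases b) auto
    ultimately show ?case by blast
  qed (simp add: initial_segment_def)
  have image: "(\<lambda>k. initial_segment (binary_digits k) n) ` {..<2 ^ n} = {\<sigma>. length \<sigma> = n}"
  proof (intro equalityI subsetI)
    fix \<sigma> :: "bool list" assume "\<sigma> \<in> {\<sigma>. length \<sigma> = n}"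
    with surj[of \<sigma>] show "\<sigma> \<in> (\<lambda>k. initial_segment (binary_digits k) n) ` {..<2 ^ n}" by force
  qed auto
  have "card {\<sigma> :: bool list. length \<sigma> = n} = 2 ^ n"
    using card_lists_length_eq[of "UNIV :: bool set" n] by simp
  with image have "inj_on (\<lambda>k. initial_segment (binary_digits k) n) {..<2 ^ n}"
    by (intro eq_card_imp_inj_on) auto
  with image show ?thesis by (simp add: bij_betw_def)
qed

section \<open>Topology and measure on Cantor space\<close>

lemma open_cylinder: "open (cylinder \<sigma>)"
proof -
  have "cylinder \<sigma> = (\<Inter>i\<in>{..<length \<sigma>}. (\<lambda>X. X i) -` {\<sigma> ! i})"
    by (auto simp: cylinder_def)
  moreover have "open ((\<lambda>X :: cantor. X i) -` {\<sigma> ! i})" for i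
    by (intro open_vimage continuous_on_product_coordinates) (rule Topological_Spaces.open_discrete)
  ultimately show ?thesis by (simp add: open_INT)
qed

lemma cylinder_borel [measurable]: "cylinder \<sigma> \<in> sets borel"
  by (rule borel_open[OF open_cylinder])

lemma closed_cylinder: "closed (cylinder \<sigma>)"
proof -
  have "- cylinder \<sigma> = (\<Union>\<tau>\<in>{\<tau>. length \<tau> = length \<sigma> \<and> \<tau> \<noteq> \<sigma>}. cylinder \<tau>)"
    by (auto simp: in_cylinder_iff)
  then show ?thesis unfolding closed_def by (simp add: open_UN open_cylinder)
qed

lemma singleton_cantor_borel: "{X :: cantor} \<in> sets borel"
proof -
  have "{X} = (\<Inter>n. cylinder (initial_segment X n))"
    by (auto simp: in_cylinder_iff initial_segment_eq_iff fun_eq_iff) (metis lessI)+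
  then show ?thesis by (metis borel_closed closed_INT closed_cylinder)
qed

lemma open_contains_cylinder:
  fixes X :: cantor
  assumes "open T" "X \<in> T"
  shows "\<exists>n. cylinder (initial_segment X n) \<subseteq> T"
proof -
  have "openin (product_topology (\<lambda>_::nat. euclidean :: bool topology) UNIV) T"
    using assms(1) by (simp add: euclidean_product_topology)
  from product_topology_open_contains_basis[OF this assms(2)]
  obtain V where V: "X \<in> (\<Pi>\<^sub>E i\<in>UNIV. V i)" "finite {i. V i \<noteq> UNIV}" "(\<Pi>\<^sub>E i\<in>UNIV. V i) \<subseteq> T"
    by auto
  from V(2) obtain n where n: "{i. V i \<noteq> UNIV} \<subseteq> {..<n}"
    using finite_nat_iff_bounded by blast
  have "cylinder (initial_segment X n) \<subseteq> (\<Pi>\<^sub>E i\<in>UNIV. V i)"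
  proof
    fix Y assume "Y \<in> cylinder (initial_segment X n)"
    then have eq: "\<forall>i<n. Y i = X i" by (simp add: in_cylinder_iff initial_segment_eq_iff)
    have "Y i \<in> V i" for i
    proof (cases "i < n")
      case True
      then show ?thesis using eq V(1) by (simp add: PiE_iff)
    next
      case False
      then have "V i = UNIV" using n by auto
      then show ?thesis by simp
    qed
    then show "Y \<in> (\<Pi>\<^sub>E i\<in>UNIV. V i)" by (simp add: PiE_iff)
  qed
  with V(3) show ?thesis by blast
qed

lemma isolated_in_iff_cylinder:
  fixes X :: cantor
  shows "X isolated_in P \<longleftrightarrow> (\<exists>n. P \<inter> cylinder (initial_segment X n) = {X})"
proof
  assume "X isolated_in P"
  then obtain T where T: "X \<in> P" "open T" "T \<inter> P = {X}" by (auto simp: isolated_in_def)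
  then obtain n where "cylinder (initial_segment X n) \<subseteq> T"
    using open_contains_cylinder[of T X] by blast
  moreover have "X \<in> cylinder (initial_segment X n)" by (simp add: in_cylinder_iff)
  ultimately show "\<exists>n. P \<inter> cylinder (initial_segment X n) = {X}" using T by blast
next
  assume "\<exists>n. P \<inter> cylinder (initial_segment X n) = {X}"
  then show "X isolated_in P"
    unfolding isolated_in_def using open_cylinder by blast
qed

lemma compact_UNIV_cantor: "compact (UNIV :: cantor set)"
proof -
  have "compactin (product_topology (\<lambda>_::nat. euclidean :: bool topology) UNIV) (PiE UNIV (\<lambda>_. UNIV))"
    unfolding compactin_PiE by (simp add: finite_imp_compact)
  then show ?thesis by (simp add: euclidean_product_topology)
qed

section \<open>Effectively closed classes and random points\<close>

lemma Pi01_classE: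
  assumes "Pi01_class P"
  obtains Q where "decidable_in {} (\<lambda>p. Q (pfst p) (psnd p))"
    "P = - (\<Union>\<sigma>\<in>{\<sigma>. \<exists>s. Q (string_code \<sigma>) s}. cylinder \<sigma>)"
proof -
  from assms obtain W where "comp_enumerable W" and P: "P = - (\<Union>\<sigma>\<in>{\<sigma>. string_code \<sigma> \<in> W}. cylinder \<sigma>)"
    unfolding Pi01_class_def by blast
  then obtain Q where Q: "decidable_in {} (\<lambda>p. Q (pfst p) (psnd p))" and W: "W = {n. \<exists>s. Q n s}"
    unfolding comp_enumerable_iff_projection by blast
  from P have "P = - (\<Union>\<sigma>\<in>{\<sigma>. \<exists>s. Q (string_code \<sigma>) s}. cylinder \<sigma>)"
    unfolding W by simp
  with Q show thesis by (rule that)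
qed

text \<open>The strings of the same length as \<open>\<rho>\<close> but different from it are
  removed as well.\<close>

lemma Pi01_class_inter_cylinder:
  assumes "Pi01_class P"
  shows "Pi01_class (P \<inter> cylinder \<rho>)"
proof -
  from assms obtain Q where Q: "decidable_in {} (\<lambda>p. Q (pfst p) (psnd p))"
    and P: "P = - (\<Union>\<sigma>\<in>{\<sigma>. \<exists>s. Q (string_code \<sigma>) s}. cylinder \<sigma>)"
    using Pi01_classE by blast
  let ?Q = "\<lambda>n s. Q n s \<or> (code_length n = length \<rho> \<and> n \<noteq> string_code \<rho>)"
  have "decidable_in {} (\<lambda>p. ?Q (pfst p) (psnd p))"
    by (intro recursive_intros Q)
  then have "comp_enumerable {n. \<exists>s. ?Q n s}"
    unfolding comp_enumerable_iff_projection by (intro exI conjI) (assumption, rule refl)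
  moreover have "P \<inter> cylinder \<rho> = - (\<Union>\<sigma>\<in>{\<sigma>. string_code \<sigma> \<in> {n. \<exists>s. ?Q n s}}. cylinder \<sigma>)"
  proof (intro set_eqI iffI)
    fix X assume X: "X \<in> - (\<Union>\<sigma>\<in>{\<sigma>. string_code \<sigma> \<in> {n. \<exists>s. ?Q n s}}. cylinder \<sigma>)"
    have "initial_segment X (length \<rho>) = \<rho>"
    proof (rule ccontr)
      assume "initial_segment X (length \<rho>) \<noteq> \<rho>"
      then have "string_code (initial_segment X (length \<rho>)) \<in> {n. \<exists>s. ?Q n s}" by simp
      with X have "X \<notin> cylinder (initial_segment X (length \<rho>))" by blast
      then show False by (simp add: in_cylinder_iff)
    qed
    with X show "X \<in> P \<inter> cylinder \<rho>" unfolding P by (simp add: in_cylinder_iff)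
  qed (auto simp: P in_cylinder_iff)
  ultimately show ?thesis unfolding Pi01_class_def by blast
qed

text \<open>
  Since \<open>Z\<close> itself is never removed from the class, the strings of length \<open>i\<close> that are seen to
  contain all surviving points form the enumerable set consisting of the initial segment of \<open>Z\<close> only.
\<close>

lemma Pi01_singleton_not_random:
  assumes "Pi01_class {Z}"
  shows "\<not> martin_loef_random lebesgue_cantor Z"
proof -
  from assms obtain Q where Q: "decidable_in {} (\<lambda>p. Q (pfst p) (psnd p))"
    and Z: "{Z} = - (\<Union>\<sigma>\<in>{\<sigma>. \<exists>s. Q (string_code \<sigma>) s}. cylinder \<sigma>)"
    using Pi01_classE by blast
  have survives: "\<not> Q (string_code (initial_segment Z l)) s" for l s
  proof
    assume "Q (string_code (initial_segment Z l)) s"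
    moreover have "Z \<in> cylinder (initial_segment Z l)" by (simp add: in_cylinder_iff)
    ultimately have "Z \<notin> {Z}" unfolding Z by blast
    then show False by simp
  qed
  \<comment> \<open>By stage \<open>L\<close> a prefix of \<open>X\<close> of length at most
    \<open>L\<close> has been thrown out; this depends on the first \<open>L\<close> bits of
    \<open>X\<close> only.\<close>
  define removed where "removed X L \<longleftrightarrow>
    (\<exists>l\<le>L. \<exists>s\<le>L. Q (string_code (initial_segment X l)) s)" for X L
  \<comment> \<open>Here \<open>p\<close> pairs a length with a string code. The numbers
    \<open>k < 2 ^ L\<close> run through all strings of length \<open>L\<close>, each of which must
    be removed or extend the coded string.\<close>
  define V where "V p L \<longleftrightarrow> code_length (psnd p) = pfst p \<and> pfst p \<le> L \<and>
    (\<forall>k<2 ^ L. removed (binary_digits k) L \<or>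
       string_code (initial_segment (binary_digits k) (pfst p)) = psnd p)" for p L
  define U where "U i = (\<Union>\<sigma>\<in>{\<sigma>. prod_encode (i, string_code \<sigma>) \<in> {p. \<exists>L. V p L}}. cylinder \<sigma>)"
    for i
  have "decidable_in {} (\<lambda>p. V (pfst p) (psnd p))"
    unfolding V_def removed_def by (intro recursive_intros decidable_in_comp2[OF Q])
  then have "uniformly_Sigma01 U"
    unfolding uniformly_Sigma01_def U_def comp_enumerable_iff_projection
    by (intro exI[of _ "{p. \<exists>L. V p L}"] conjI exI[of _ V] allI refl)
  moreover have U: "U i = cylinder (initial_segment Z i)" for i
  proof -
    have "\<exists>L. V (prod_encode (i, string_code (initial_segment Z i))) L"
    proof -
      \<comment> \<open>By compactness finitely many removed cylinders cover the complement of the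
        cylinder around \<open>Z\<close>.\<close>
      let ?C = "- cylinder (initial_segment Z i)"
      have "compact ?C"
        using compact_Int_closed[OF compact_UNIV_cantor, of ?C] by (simp add: closed_def open_cylinder)
      moreover have "?C \<subseteq> (\<Union>\<sigma>\<in>{\<sigma>. \<exists>s. Q (string_code \<sigma>) s}. cylinder \<sigma>)"
      proof -
        have "Z \<in> cylinder (initial_segment Z i)" by (simp add: in_cylinder_iff)
        then have "?C \<subseteq> - {Z}" by blast
        then show ?thesis unfolding Z by simp
      qed
      ultimately obtain S where S: "S \<subseteq> {\<sigma>. \<exists>s. Q (string_code \<sigma>) s}" "finite S"
        and C: "?C \<subseteq> (\<Union>\<sigma>\<in>S. cylinder \<sigma>)"
        by (rule compactE_image[OF _ open_cylinder])
      from S(1) have "\<forall>\<sigma>\<in>S. \<exists>s. Q (string_code \<sigma>) s" by blast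
      then obtain st where st: "\<And>\<sigma>. \<sigma> \<in> S \<Longrightarrow> Q (string_code \<sigma>) (st \<sigma>)"
        using bchoice[of S "\<lambda>\<sigma>. Q (string_code \<sigma>)"] by blast
      \<comment> \<open>Bounds \<open>i\<close> and the lengths and stages of the finite
        subcover.\<close>
      define L where "L = i + (\<Sum>\<sigma>\<in>S. length \<sigma> + st \<sigma>)"
      have L: "length \<sigma> + st \<sigma> \<le> L" if "\<sigma> \<in> S" for \<sigma>
        using member_le_sum[of \<sigma> S "\<lambda>\<sigma>. length \<sigma> + st \<sigma>"] S(2) that by (simp add: L_def)
      have "removed X L" if X: "initial_segment X i \<noteq> initial_segment Z i" for X
      proof -
        from X C obtain \<sigma> where \<sigma>: "\<sigma> \<in> S" "initial_segment X (length \<sigma>) = \<sigma>"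
          by (auto simp: in_cylinder_iff)
        then show ?thesis
          unfolding removed_def using L[OF \<sigma>(1)] st[OF \<sigma>(1)]
          by (intro exI[of _ "length \<sigma>"] conjI exI[of _ "st \<sigma>"]) auto
      qed
      then have "V (prod_encode (i, string_code (initial_segment Z i))) L"
        by (auto simp: V_def L_def)
      then show ?thesis by blast
    qed
    moreover have "\<sigma> = initial_segment Z i" if "V (prod_encode (i, string_code \<sigma>)) L" for \<sigma> L
    proof -
      from that have len: "length \<sigma> = i" "i \<le> L" by (auto simp: V_def)
      \<comment> \<open>The initial segment of \<open>Z\<close> of length \<open>L\<close> is never
        removed, so \<open>V\<close> forces it to extend \<open>\<sigma>\<close>.\<close>
      have "initial_segment Z L \<in> (\<lambda>k. initial_segment (binary_digits k) L) ` {..<2 ^ L}"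
        unfolding bij_betw_imp_surj_on[OF bij_betw_binary_digits] by simp
      then obtain k where k: "k < 2 ^ L" "initial_segment (binary_digits k) L = initial_segment Z L"
        by auto
      have "\<not> removed Z L" unfolding removed_def using survives by blast
      then have "\<not> removed (binary_digits k) L"
        unfolding removed_def using initial_segment_le[OF k(2)] by metis
      with that k(1) have "initial_segment (binary_digits k) i = \<sigma>" by (auto simp: V_def)
      with initial_segment_le[OF k(2) len(2)] show ?thesis by simp
    qed
    ultimately show ?thesis unfolding U_def by auto
  qed
  ultimately have "martin_loef_test lebesgue_cantor U"
    unfolding martin_loef_test_def by (simp add: lebesgue_cantor_cylinder)
  moreover have "Z \<in> (\<Inter>i. U i)" by (simp add: U in_cylinder_iff)
  ultimately show ?thesis unfolding martin_loef_random_def by blast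
qed


lemma sets_lebesgue_cantor: "sets lebesgue_cantor = sets borel"
  using probability_measure_lebesgue_cantor by (simp add: probability_measure_def)

lemma space_lebesgue_cantor: "space lebesgue_cantor = UNIV"
  using sets_eq_imp_space_eq[OF sets_lebesgue_cantor] by simp

lemma prob_space_lebesgue_cantor: "prob_space lebesgue_cantor"
  using probability_measure_lebesgue_cantor by (simp add: probability_measure_def)

section \<open>Pushforward measures along length-preserving computable functionals\<close>

text \<open>Since \<open>n\<close> input bits determine \<open>n\<close> output bits, such a
  functional acts on the strings of each length, and its pushforward gives cylinders dyadic rational
  measures.\<close>

locale computable_functional =
  fixes \<Phi> :: "cantor \<Rightarrow> cantor"
  assumes causal: "initial_segment X n = initial_segment Y n \<Longrightarrow>
      initial_segment (\<Phi> X) n = initial_segment (\<Phi> Y) n"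
    and decidable_functional: "decidable_in {} (\<lambda>p. \<Phi> (decoded_string (pfst p)) (psnd p))"
begin

definition string_map :: "bool list \<Rightarrow> bool list" where
  "string_map \<tau> = initial_segment (\<Phi> (decoded_string (string_code \<tau>))) (length \<tau>)"

definition code_map :: "nat \<Rightarrow> nat" where
  "code_map c = string_code (initial_segment (\<Phi> (decoded_string c)) (code_length c))"

lemma code_map_string_code: "code_map (string_code \<tau>) = string_code (string_map \<tau>)"
  by (simp add: code_map_def string_map_def)

lemma length_string_map [simp]: "length (string_map \<tau>) = length \<tau>"
  by (simp add: string_map_def)

lemma recursive_in_code_map [recursive_intros]:
  assumes "recursive_in {} f"
  shows "recursive_in {} (\<lambda>n. code_map (f n))"
  unfolding code_map_def
  by (intro recursive_intros decidable_in_comp2[OF decidable_functional] recursive_in_comp[OF assms] assms)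

lemma string_map_initial_segment:
  "string_map (initial_segment X n) = initial_segment (\<Phi> X) n"
proof -
  have "initial_segment (decoded_string (string_code (initial_segment X n))) n = initial_segment X n"
    using initial_segment_decoded_string[of "initial_segment X n"] by simp
  from causal[OF this] show ?thesis by (simp add: string_map_def)
qed

lemma vimage_cylinder: "\<Phi> -` cylinder \<sigma> = (\<Union>\<tau>\<in>{\<tau>. string_map \<tau> = \<sigma>}. cylinder \<tau>)"
proof (intro set_eqI iffI)
  fix X assume "X \<in> \<Phi> -` cylinder \<sigma>"
  then have "string_map (initial_segment X (length \<sigma>)) = \<sigma>"
    by (simp add: in_cylinder_iff string_map_initial_segment)
  moreover have "X \<in> cylinder (initial_segment X (length \<sigma>))"
    by (simp add: in_cylinder_iff)
  ultimately show "X \<in> (\<Union>\<tau>\<in>{\<tau>. string_map \<tau> = \<sigma>}. cylinder \<tau>)" by blast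
next
  fix X assume "X \<in> (\<Union>\<tau>\<in>{\<tau>. string_map \<tau> = \<sigma>}. cylinder \<tau>)"
  then obtain \<tau> where "string_map \<tau> = \<sigma>" "initial_segment X (length \<tau>) = \<tau>"
    by (auto simp: in_cylinder_iff)
  then show "X \<in> \<Phi> -` cylinder \<sigma>"
    using string_map_initial_segment[of X "length \<tau>"] by (auto simp: in_cylinder_iff)
qed

text \<open>As \<open>\<Phi>\<close> preserves lengths, an enumeration of \<open>U\<close> pulls back by plain composition.\<close>

lemma vimage_Union_cylinder:
  "\<Phi> -` (\<Union>\<sigma>\<in>{\<sigma>. P (string_code \<sigma>)}. cylinder \<sigma>)
    = (\<Union>\<tau>\<in>{\<tau>. P (code_map (string_code \<tau>))}. cylinder \<tau>)"
  unfolding vimage_UN vimage_cylinder code_map_string_code by blast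

lemma uniformly_Sigma01_vimage:
  assumes "uniformly_Sigma01 U"
  shows "uniformly_Sigma01 (\<lambda>i. \<Phi> -` U i)"
proof -
  from assms obtain W where W: "comp_enumerable W"
    and U: "\<And>i. U i = (\<Union>\<sigma>\<in>{\<sigma>. prod_encode (i, string_code \<sigma>) \<in> W}. cylinder \<sigma>)"
    unfolding uniformly_Sigma01_def by blast
  let ?f = "\<lambda>p. prod_encode (pfst p, code_map (psnd p))"
  have "comp_enumerable (?f -` W)"
    by (intro comp_enumerable_vimage W recursive_intros)
  moreover have "\<Phi> -` U i = (\<Union>\<sigma>\<in>{\<sigma>. prod_encode (i, string_code \<sigma>) \<in> ?f -` W}. cylinder \<sigma>)" for i
    unfolding U vimage_Union_cylinder[of "\<lambda>c. prod_encode (i, c) \<in> W"] by simp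
  ultimately show ?thesis unfolding uniformly_Sigma01_def by blast
qed

lemma Pi01_class_vimage:
  assumes "Pi01_class P"
  shows "Pi01_class (\<Phi> -` P)"
proof -
  from assms obtain W where W: "comp_enumerable W"
    and P: "P = - (\<Union>\<sigma>\<in>{\<sigma>. string_code \<sigma> \<in> W}. cylinder \<sigma>)"
    unfolding Pi01_class_def by blast
  have "comp_enumerable (code_map -` W)"
    by (intro comp_enumerable_vimage W recursive_intros)
  moreover have "\<Phi> -` P = - (\<Union>\<sigma>\<in>{\<sigma>. string_code \<sigma> \<in> code_map -` W}. cylinder \<sigma>)"
    unfolding P vimage_Compl vimage_Union_cylinder[of "\<lambda>c. c \<in> W"] by simp
  ultimately show ?thesis unfolding Pi01_class_def by blast
qed

lemma measurable_functional: "\<Phi> \<in> borel_measurable borel"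
proof (rule borel_measurableI)
  fix S :: "cantor set" assume "open S"
  have "open (\<Phi> -` S)"
    unfolding open_subopen[of "\<Phi> -` S"]
  proof
    fix X assume "X \<in> \<Phi> -` S"
    with \<open>open S\<close> obtain n where n: "cylinder (initial_segment (\<Phi> X) n) \<subseteq> S"
      using open_contains_cylinder[of S "\<Phi> X"] by auto
    have "cylinder (initial_segment X n) \<subseteq> \<Phi> -` cylinder (initial_segment (\<Phi> X) n)"
      by (auto simp: in_cylinder_iff intro: causal)
    with n have "cylinder (initial_segment X n) \<subseteq> \<Phi> -` S" by blast
    moreover have "X \<in> cylinder (initial_segment X n)" by (simp add: in_cylinder_iff)
    ultimately show "\<exists>T. open T \<and> X \<in> T \<and> T \<subseteq> \<Phi> -` S"
      using open_cylinder by blast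
  qed
  then show "\<Phi> -` S \<inter> space borel \<in> sets borel" by simp
qed

section \<open>The pushforward of the uniform measure\<close>

definition pushforward :: "cantor measure" where
  "pushforward = distr lebesgue_cantor borel \<Phi>"

lemma measurable_lebesgue_cantor: "\<Phi> \<in> measurable lebesgue_cantor borel"
  using measurable_functional measurable_cong_sets[OF sets_lebesgue_cantor refl] by blast

lemma measure_pushforward:
  "S \<in> sets borel \<Longrightarrow> measure pushforward S = measure lebesgue_cantor (\<Phi> -` S)"
  unfolding pushforward_def
  by (simp add: measure_distr measurable_lebesgue_cantor space_lebesgue_cantor)

lemma probability_measure_pushforward: "probability_measure pushforward"
  unfolding probability_measure_def pushforward_def
  using prob_space.prob_space_distr[OF prob_space_lebesgue_cantor measurable_lebesgue_cantor] by simp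

text \<open>The preimages of a test for the pushforward form a test for the uniform measure: the
  enumeration pulls back and the measures are equal. A test capturing \<open>\<Phi> X\<close> would
  yield one capturing \<open>X\<close>.\<close>

lemma martin_loef_random_pushforward:
  assumes "martin_loef_random lebesgue_cantor X"
  shows "martin_loef_random pushforward (\<Phi> X)"
  unfolding martin_loef_random_def
proof (intro allI impI)
  fix U assume U: "martin_loef_test pushforward U"
  then have Sigma: "uniformly_Sigma01 U" by (simp add: martin_loef_test_def)
  have "U i \<in> sets borel" for i
  proof -
    from Sigma obtain W where "U i = (\<Union>\<sigma>\<in>{\<sigma>. prod_encode (i, string_code \<sigma>) \<in> W}. cylinder \<sigma>)"
      unfolding uniformly_Sigma01_def by blast
    then have "open (U i)" by (simp add: open_UN open_cylinder)
    then show ?thesis by (rule borel_open)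
  qed
  then have "martin_loef_test lebesgue_cantor (\<lambda>i. \<Phi> -` U i)"
    using U uniformly_Sigma01_vimage[OF Sigma]
    by (simp add: martin_loef_test_def measure_pushforward)
  with assms show "\<Phi> X \<notin> (\<Inter>i. U i)"
    unfolding martin_loef_random_def by blast
qed

lemma finite_fiber: "finite {\<tau>. string_map \<tau> = \<sigma>}"
  by (rule finite_subset[OF _ finite_bool_lists_length_eq[of "length \<sigma>"]]) auto

text \<open>A bounded sum, hence recursive; for the code of a string, division by
  \<open>2 ^ code_length c\<close> gives the measure of its cylinder.\<close>

definition preimage_count :: "nat \<Rightarrow> nat" where
  "preimage_count c = (\<Sum>k<2 ^ code_length c.
     of_bool (code_map (string_code (initial_segment (binary_digits k) (code_length c))) = c))"

lemma preimage_count_string_code: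
  "preimage_count (string_code \<sigma>) = card {\<tau>. string_map \<tau> = \<sigma>}"
proof -
  let ?A = "{\<tau> :: bool list. length \<tau> = length \<sigma>}"
  have fin: "finite ?A" by (rule finite_bool_lists_length_eq)
  have "preimage_count (string_code \<sigma>) = (\<Sum>\<tau>\<in>?A. of_bool (string_map \<tau> = \<sigma>))"
    unfolding preimage_count_def code_length_string_code code_map_string_code string_code_eq_iff
    by (rule sum.reindex_bij_betw[OF bij_betw_binary_digits, where g = "\<lambda>\<tau>. of_bool (string_map \<tau> = \<sigma>)"])
  also have "\<dots> = card (?A \<inter> {\<tau>. string_map \<tau> = \<sigma>})"
    using fin by (simp add: of_bool_def sum.If_cases)
  also have "?A \<inter> {\<tau>. string_map \<tau> = \<sigma>} = {\<tau>. string_map \<tau> = \<sigma>}"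
    by auto
  finally show ?thesis .
qed

lemma recursive_in_preimage_count [recursive_intros]:
  assumes "recursive_in {} f"
  shows "recursive_in {} (\<lambda>n. preimage_count (f n))"
  unfolding preimage_count_def
  by (intro recursive_intros assms recursive_in_comp[OF assms])

lemma measure_pushforward_cylinder:
  "measure pushforward (cylinder \<sigma>) = preimage_count (string_code \<sigma>) / 2 ^ length \<sigma>"
proof -
  interpret prob_space lebesgue_cantor by (rule prob_space_lebesgue_cantor)
  let ?T = "{\<tau>. string_map \<tau> = \<sigma>}"
  have len: "length \<tau> = length \<sigma>" if "\<tau> \<in> ?T" for \<tau>
    using that by auto
  have "measure pushforward (cylinder \<sigma>) = measure lebesgue_cantor (\<Union>\<tau>\<in>?T. cylinder \<tau>)"
    by (simp add: measure_pushforward vimage_cylinder)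
  also have "\<dots> = (\<Sum>\<tau>\<in>?T. measure lebesgue_cantor (cylinder \<tau>))"
  proof (rule finite_measure_finite_Union[OF finite_fiber])
    show "disjoint_family_on cylinder ?T"
      unfolding disjoint_family_on_def
    proof (intro ballI impI)
      fix \<tau> \<upsilon> assume "\<tau> \<in> ?T" "\<upsilon> \<in> ?T" "\<tau> \<noteq> \<upsilon>"
      with len[of \<tau>] len[of \<upsilon>] show "cylinder \<tau> \<inter> cylinder \<upsilon> = {}"
        by (simp add: disjoint_iff in_cylinder_iff)
    qed
  qed (simp add: sets_lebesgue_cantor image_subset_iff)
  also have "\<dots> = (\<Sum>\<tau>\<in>?T. (1/2) ^ length \<sigma>)"
    by (intro sum.cong refl) (simp only: lebesgue_cantor_cylinder len)
  finally show ?thesis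
    by (simp add: preimage_count_string_code power_divide)
qed

lemma computable_measure_pushforward: "computable_measure pushforward"
proof -
  \<comment> \<open>The exact value serves at every precision. In \<open>decode_rat\<close> an even
    first component \<open>2 * m\<close> codes the integer \<open>m\<close>, and the denominator is
    stored less one.\<close>
  define q where "q p = prod_encode (2 * preimage_count (pfst p), 2 ^ code_length (pfst p) - 1)" for p
  have "int_decode (2 * m) = int m" for m
    using int_encode_inverse[of "int m"] by (simp add: int_encode_def sum_encode_def)
  then have "of_rat (decode_rat (q (prod_encode (string_code \<sigma>, n)))) = measure pushforward (cylinder \<sigma>)"
    for \<sigma> n
    by (simp add: decode_rat_def q_def measure_pushforward_cylinder of_rat_divide of_rat_power
        flip: of_nat_Suc)
  moreover have "computable q"
    unfolding computable_def recursive_in_def[symmetric] q_def by (intro recursive_intros)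
  ultimately show ?thesis
    unfolding computable_measure_def computable_real_on_strings_def
    by (intro exI[of _ q]) simp
qed

lemma measure_pushforward_cylinder_pos:
  "measure pushforward (cylinder \<sigma>) > 0 \<longleftrightarrow> preimage_count (string_code \<sigma>) \<noteq> 0"
  by (simp add: measure_pushforward_cylinder zero_less_divide_iff)

section \<open>The support as an effectively closed class\<close>

lemma Pi01_class_support: "Pi01_class (measure_support pushforward)"
proof -
  \<comment> \<open>Whether a cylinder has measure zero is decidable; the vacuous quantifier over
    \<open>s\<close> gives the set the form of a projection.\<close>
  have "comp_enumerable {c. \<exists>s::nat. preimage_count c = 0}"
    unfolding comp_enumerable_iff_projection
    by (intro exI[of _ "\<lambda>c _. preimage_count c = 0"] conjI refl recursive_intros)
  moreover have "measure_support pushforward =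
    - (\<Union>\<sigma>\<in>{\<sigma>. string_code \<sigma> \<in> {c. \<exists>s::nat. preimage_count c = 0}}. cylinder \<sigma>)"
  proof -
    have "(\<forall>n. preimage_count (string_code (initial_segment Y n)) \<noteq> 0) \<longleftrightarrow>
        (\<forall>\<sigma>. preimage_count (string_code \<sigma>) = 0 \<longrightarrow> initial_segment Y (length \<sigma>) \<noteq> \<sigma>)"
      (is "?l = ?r") for Y
    proof
      assume ?r
      show ?l
      proof
        fix n
        from \<open>?r\<close>[rule_format, of "initial_segment Y n"]
        show "preimage_count (string_code (initial_segment Y n)) \<noteq> 0" by auto
      qed
    qed metis
    then show ?thesis
      unfolding measure_support_def measure_pushforward_cylinder_pos
      by (simp add: set_eq_iff in_cylinder_iff)
  qed
  ultimately show ?thesis unfolding Pi01_class_def by blast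
qed

text \<open>The support is the closure of the range of \<open>\<Phi>\<close>, because a cylinder has
  positive measure exactly if the range meets it.\<close>

lemma in_support_iff:
  "Y \<in> measure_support pushforward \<longleftrightarrow> (\<forall>n. \<exists>X. initial_segment (\<Phi> X) n = initial_segment Y n)"
proof -
  have "preimage_count (string_code \<sigma>) \<noteq> 0 \<longleftrightarrow> (\<exists>X. initial_segment (\<Phi> X) (length \<sigma>) = \<sigma>)" for \<sigma>
  proof -
    have "preimage_count (string_code \<sigma>) \<noteq> 0 \<longleftrightarrow> (\<exists>\<tau>. string_map \<tau> = \<sigma>)"
      using finite_fiber by (simp add: preimage_count_string_code)
    also have "\<dots> \<longleftrightarrow> (\<exists>X. initial_segment (\<Phi> X) (length \<sigma>) = \<sigma>)"
      using string_map_initial_segment by (metis length_string_map string_map_def)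
    finally show ?thesis .
  qed
  then show ?thesis
    unfolding measure_support_def measure_pushforward_cylinder_pos by simp
qed

lemma countably_supported_pushforward:
  assumes "countable (range \<Phi>)"
  shows "countably_supported pushforward"
proof -
  have sets: "range \<Phi> \<in> sets borel"
    by (rule sets.countable[OF _ assms]) (rule singleton_cantor_borel)
  have "range (from_nat_into (range \<Phi>)) = range \<Phi>"
    by (rule range_from_nat_into) (use assms in auto)
  moreover have "measure pushforward (range \<Phi>) = 1"
  proof -
    have "\<Phi> -` range \<Phi> = space lebesgue_cantor" by (auto simp: space_lebesgue_cantor)
    then show ?thesis
      unfolding measure_pushforward[OF sets]
      by (simp add: prob_space.prob_space[OF prob_space_lebesgue_cantor])
  qed
  ultimately show ?thesis unfolding countably_supported_def by metis
qed

end


section \<open>Following an approximation\<close>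

primrec ones :: "cantor \<Rightarrow> nat \<Rightarrow> nat" where
  "ones Y 0 = 0"
| "ones Y (Suc s) = ones Y s + of_bool (Y s)"

lemma ones_mono: "s \<le> t \<Longrightarrow> ones Y s \<le> ones Y t"
  by (induction t rule: dec_induct) auto

lemma ones_cong: "\<forall>i<n. Y i = Z i \<Longrightarrow> ones Y n = ones Z n"
  by (induction n) auto

lemma ones_constant: "t \<le> s \<Longrightarrow> \<forall>s\<ge>t. \<not> Y s \<Longrightarrow> ones Y s = ones Y t"
  by (induction s rule: dec_induct) auto

lemma ones_unbounded:
  assumes "\<forall>t. \<exists>s\<ge>t. Y s"
  shows "\<exists>s\<ge>t. Y s \<and> k \<le> ones Y s"
proof (induction k arbitrary: t)
  case 0
  then show ?case using assms by simp
next
  case (Suc k)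
  then obtain s where s: "s \<ge> t" "Y s" "k \<le> ones Y s" by blast
  from assms obtain u where u: "u \<ge> Suc s" "Y u" by blast
  have "Suc k \<le> ones Y (Suc s)" using s by simp
  also have "\<dots> \<le> ones Y u" by (rule ones_mono) (rule u)
  finally show ?case using s(1) u by (intro exI[of _ u]) auto
qed

lemma recursive_in_ones [recursive_intros]:
  assumes Y: "decidable_in \<O> (\<lambda>p. Y (pfst p) (psnd p))" and m: "recursive_in \<O> m"
  shows "recursive_in \<O> (\<lambda>n. ones (Y n) (m n))"
proof -
  have eq: "ones Y s = rec_nat 0 (\<lambda>s v. v + of_bool (Y s)) s" for Y s
    by (induction s) auto
  show ?thesis unfolding eq by (intro recursive_intros decidable_in_comp2[OF Y] m)
qed

text \<open>
  \<open>agreement X s\<close> is the number of ones of \<open>follow X\<close> before stage \<open>s\<close>. It is at most \<open>s\<close>, so that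
  the first \<open>n\<close> bits of \<open>follow X\<close> depend on the first \<open>n\<close> bits of \<open>X\<close> only.
\<close>

locale limit_approximation =
  fixes a :: "nat \<Rightarrow> cantor" and A :: cantor
  assumes decidable_approximation: "decidable_in {} (\<lambda>p. a (pfst p) (psnd p))"
    and limit: "\<And>i. \<forall>\<^sub>F s in sequentially. a s i = A i"
begin

primrec agreement :: "cantor \<Rightarrow> nat \<Rightarrow> nat" where
  "agreement X 0 = 0"
| "agreement X (Suc s) = agreement X s + of_bool (\<forall>i\<le>agreement X s. X i = a s i)"

definition follow :: "cantor \<Rightarrow> cantor" where
  "follow X s \<longleftrightarrow> (\<forall>i\<le>agreement X s. X i = a s i)"

text \<open>The counter kept by \<open>agreement\<close> can be read off the output alone, so the
  length of agreement is known from the image without knowing \<open>X\<close>.\<close>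

lemma agreement_eq_ones: "agreement X s = ones (follow X) s"
  by (induction s) (auto simp: follow_def)

lemma agreement_le: "agreement X s \<le> s"
  by (induction s) auto

lemma agreement_cong:
  assumes "\<forall>i<n. X i = Y i"
  shows "m \<le> n \<Longrightarrow> agreement X m = agreement Y m"
proof (induction m)
  case (Suc m)
  then have "agreement X m = agreement Y m" by simp
  moreover have "X i = Y i" if "i \<le> agreement Y m" for i
    using assms that agreement_le[of Y m] Suc.prems by simp
  ultimately show ?case by simp
qed simp

lemma follow_cong:
  assumes "\<forall>i<n. X i = Y i" "m < n"
  shows "follow X m = follow Y m"
proof -
  have "agreement X m = agreement Y m" using assms by (intro agreement_cong[of n]) auto
  moreover have "X i = Y i" if "i \<le> agreement Y m" for i
    using assms that agreement_le[of Y m] by simp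
  ultimately show ?thesis by (simp add: follow_def)
qed

lemma decidable_in_follow:
  assumes X: "decidable_in \<O> (\<lambda>p. X (pfst p) (psnd p))" and m: "recursive_in \<O> m"
  shows "decidable_in \<O> (\<lambda>n. follow (X n) (m n))"
proof -
  note a = decidable_in_comp2[OF decidable_in_mono[OF decidable_approximation, of \<O>]]
  have eq: "agreement X s = rec_nat 0 (\<lambda>s v. v + of_bool (\<forall>i\<le>v. X i = a s i)) s" for X s
    by (induction s) auto
  show ?thesis unfolding follow_def eq
    by (intro recursive_intros decidable_in_comp2[OF X] a m recursive_in_comp[OF m])
qed

sublocale computable_functional follow
proof
  fix X Y n assume "initial_segment X n = initial_segment Y n"
  then show "initial_segment (follow X) n = initial_segment (follow Y) n"
    using follow_cong[of n X Y] by (simp add: initial_segment_eq_iff)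
next
  show "decidable_in {} (\<lambda>p. follow (decoded_string (pfst p)) (psnd p))"
    by (intro decidable_in_follow recursive_intros)
qed

section \<open>Infinitely many ones for \<open>A\<close> only\<close>

lemma stable: "\<exists>m. \<forall>s\<ge>m. \<forall>i\<le>k. a s i = A i"
proof -
  have "\<forall>\<^sub>F s in sequentially. \<forall>i\<in>{..k}. a s i = A i"
    by (rule eventually_ball_finite) (use limit in auto)
  then show ?thesis by (auto simp: eventually_sequentially)
qed

text \<open>Without further ones the demanded length of agreement stays fixed; once the
  approximation has settled on those bits it agrees with \<open>A\<close>, and a one must
  appear.\<close>

lemma infinitely_many_ones_follow: "\<exists>s\<ge>t. follow A s"
proof (rule ccontr)
  assume no: "\<not> (\<exists>s\<ge>t. follow A s)"
  obtain m where m: "\<forall>s\<ge>m. \<forall>i\<le>agreement A t. a s i = A i" using stable by blast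
  have "agreement A (max t m) = agreement A t"
    unfolding agreement_eq_ones using no by (intro ones_constant) auto
  with m have "follow A (max t m)" by (simp add: follow_def)
  with no show False by auto
qed

text \<open>Ones preceded by many ones occur at arbitrarily late stages; at such a stage
  \<open>a s i\<close> equals \<open>X i\<close> and already has its final value
  \<open>A i\<close>.\<close>

lemma infinitely_many_ones_imp_eq:
  assumes "\<forall>t. \<exists>s\<ge>t. follow X s"
  shows "X = A"
proof
  fix i
  obtain m where m: "\<forall>s\<ge>m. \<forall>j\<le>i. a s j = A j" using stable by blast
  from ones_unbounded[OF assms] obtain s where s: "s \<ge> m" "follow X s" "i \<le> ones (follow X) s"
    by blast
  then have "X i = a s i" by (simp add: follow_def agreement_eq_ones)
  with m s(1) show "X i = A i" by simp
qed

lemma follow_eq_iff: "follow X = follow A \<longleftrightarrow> X = A"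
  using infinitely_many_ones_imp_eq infinitely_many_ones_follow by auto

text \<open>By stage \<open>m\<close> the approximation has settled on the
  \<open>ones Y t + 1\<close> bits that the next one requires. If \<open>follow X\<close> agrees
  with \<open>Y\<close> through this stage, \<open>X\<close> differs from a settled bit, and no
  further one can appear.\<close>

lemma finitely_many_ones_determined:
  assumes "\<forall>s\<ge>t. \<not> Y s"
  shows "\<exists>m. \<forall>X. initial_segment (follow X) m = initial_segment Y m \<longrightarrow> follow X = Y"
proof -
  obtain m0 where m0: "\<forall>s\<ge>m0. \<forall>i\<le>ones Y t. a s i = A i" using stable by blast
  define m where "m = max t m0"
  \<comment> \<open>The length is \<open>Suc m\<close> because the zero at position \<open>m\<close>
    itself is what shows that \<open>X\<close> disagrees with the approximation.\<close>
  have "follow X = Y" if "initial_segment (follow X) (Suc m) = initial_segment Y (Suc m)" for X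
  proof -
    from that have eq: "follow X i = Y i" if "i < Suc m" for i
      using that by (simp add: initial_segment_eq_iff)
    have "agreement X m = ones Y m"
      unfolding agreement_eq_ones by (intro ones_cong) (use eq in auto)
    also have "\<dots> = ones Y t"
      by (intro ones_constant assms) (simp add: m_def)
    finally have N: "agreement X m = ones Y t" .
    have "\<not> follow X m" using eq[of m] assms by (simp add: m_def)
    with N obtain i where i: "i \<le> ones Y t" "X i \<noteq> a m i" by (auto simp: follow_def)
    then have neq: "X i \<noteq> a s i" if "s \<ge> m" for s
      using m0 that by (simp add: m_def)
    have "agreement X s = ones Y t" if "m \<le> s" for s
      using that
    proof (induction s rule: dec_induct)
      case (step s)
      with neq[of s] i(1) show ?case by auto
    qed (rule N)
    then have "\<not> follow X s" if "s \<ge> m" for s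
      using neq[OF that] i(1) that by (auto simp: follow_def)
    then show ?thesis
      using eq assms by (intro ext) (metis less_Suc_eq_le max.bounded_iff m_def nle_le)
  qed
  then show ?thesis by blast
qed

section \<open>The derivative of the support, and its countable carrier\<close>

lemma follow_in_support: "follow X \<in> measure_support pushforward"
  unfolding in_support_iff by blast

text \<open>With infinitely many ones \<open>Y\<close> would be \<open>follow A\<close>. Otherwise
  finitely many bits determine it among the images, hence also in their closure.\<close>

lemma isolated_in_support:
  assumes Y: "Y \<in> measure_support pushforward" and "Y \<noteq> follow A"
  shows "Y isolated_in measure_support pushforward"
proof -
  have "\<exists>t. \<forall>s\<ge>t. \<not> Y s"
  proof (rule ccontr)
    assume "\<not> (\<exists>t. \<forall>s\<ge>t. \<not> Y s)"
    then have inf: "\<forall>t. \<exists>s\<ge>t. Y s" by blast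
    \<comment> \<open>An image sharing with \<open>Y\<close> a late one that has at least
      \<open>k\<close> ones before it comes from some \<open>X\<close> agreeing with
      \<open>A\<close> up to bit \<open>k\<close>, which fixes output bit \<open>k\<close>.\<close>
    have "Y k = follow A k" for k
    proof -
      obtain m where m: "\<forall>s\<ge>m. \<forall>i\<le>k. a s i = A i" using stable by blast
      from ones_unbounded[OF inf] obtain s where s: "s \<ge> max m k" "Y s" "k \<le> ones Y s" by blast
      from Y obtain X where X: "initial_segment (follow X) (Suc s) = initial_segment Y (Suc s)"
        unfolding in_support_iff by blast
      then have eq: "\<forall>i<Suc s. follow X i = Y i" by (simp add: initial_segment_eq_iff)
      then have "agreement X s = ones Y s"
        unfolding agreement_eq_ones by (intro ones_cong) auto
      moreover have "follow X s" using eq s(2) by simp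
      ultimately have "\<forall>i<Suc k. X i = A i"
        using s m by (simp add: follow_def)
      then have "follow X k = follow A k" by (rule follow_cong) simp
      moreover have "follow X k = Y k" using eq s(1) by simp
      ultimately show ?thesis by simp
    qed
    with \<open>Y \<noteq> follow A\<close> show False by blast
  qed
  then obtain m where
    m: "\<And>X. initial_segment (follow X) m = initial_segment Y m \<Longrightarrow> follow X = Y"
    using finitely_many_ones_determined by blast
  \<comment> \<open>Every bit of \<open>Z\<close> is shared by an image that agrees with
    \<open>Z\<close> on at least \<open>m\<close> bits, and such an image is
    \<open>Y\<close>.\<close>
  have "Z = Y" if Z: "Z \<in> measure_support pushforward" "initial_segment Z m = initial_segment Y m" for Z
  proof
    fix i
    from Z(1) obtain X where X: "initial_segment (follow X) (max m (Suc i)) = initial_segment Z (max m (Suc i))"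
      unfolding in_support_iff by blast
    from initial_segment_le[OF X, of m] Z(2) have "follow X = Y" by (intro m) simp
    with X show "Z i = Y i" by (simp add: initial_segment_eq_iff)
  qed
  then have "measure_support pushforward \<inter> cylinder (initial_segment Y m) = {Y}"
    using Y by (auto simp: in_cylinder_iff)
  then show ?thesis unfolding isolated_in_iff_cylinder by blast
qed

text \<open>Flipping bit \<open>n\<close> of \<open>A\<close> keeps the first \<open>n\<close>
  output bits but changes the image, since \<open>A\<close> is the only preimage of
  \<open>follow A\<close>.\<close>

lemma follow_not_isolated: "\<not> follow A isolated_in measure_support pushforward"
proof
  assume "follow A isolated_in measure_support pushforward"
  then obtain n where n: "measure_support pushforward \<inter> cylinder (initial_segment (follow A) n) = {follow A}"
    unfolding isolated_in_iff_cylinder by blast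
  define X where "X = A(n := \<not> A n)"
  have "initial_segment (follow X) n = initial_segment (follow A) n"
    by (rule causal) (simp add: X_def initial_segment_eq_iff)
  then have "follow X \<in> measure_support pushforward \<inter> cylinder (initial_segment (follow A) n)"
    using follow_in_support by (simp add: in_cylinder_iff)
  with n have "X = A" by (simp add: follow_eq_iff)
  then have "X n = A n" by simp
  then show False by (simp add: X_def)
qed

lemma derivative_support: "derivative (measure_support pushforward) = {follow A}"
  unfolding derivative_def using isolated_in_support follow_not_isolated follow_in_support by blast

text \<open>Every value except \<open>follow A\<close> is a finite string continued by
  zeros.\<close>

lemma countable_range_follow: "countable (range follow)"
proof -
  have "range follow \<subseteq> insert (follow A) (range (\<lambda>\<sigma> i. i < length \<sigma> \<and> \<sigma> ! i))"
  proof
    fix Y assume "Y \<in> range follow"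
    then obtain X where Y: "Y = follow X" by blast
    show "Y \<in> insert (follow A) (range (\<lambda>\<sigma> i. i < length \<sigma> \<and> \<sigma> ! i))"
    proof (cases "X = A")
      case False
      with infinitely_many_ones_imp_eq obtain t where t: "\<forall>s\<ge>t. \<not> follow X s" by blast
      have "Y = (\<lambda>i. i < length (initial_segment Y t) \<and> initial_segment Y t ! i)"
      proof
        fix i
        show "Y i = (i < length (initial_segment Y t) \<and> initial_segment Y t ! i)"
          using t by (cases "i < t") (simp_all add: Y initial_segment_def)
      qed
      then show ?thesis by blast
    qed (simp add: Y)
  qed
  then show ?thesis by (rule countable_subset) auto
qed

section \<open>Turing equivalence with \<open>A\<close>, and isolation in effectively closed
  classes\<close>

lemma turing_le_follow: "turing_le (follow A) A"
proof -
  let ?\<O> = "{\<lambda>n. of_bool (A n)} :: (nat \<Rightarrow> nat) set"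
  have A: "decidable_in ?\<O> A" unfolding decidable_in_def by (rule recursive_in_oracle) simp
  have "decidable_in ?\<O> (\<lambda>n. follow A n)"
    by (intro decidable_in_follow recursive_intros decidable_in_comp[OF A])
  then show ?thesis by (simp add: turing_le_def decidable_in_def recursive_in_def)
qed

text \<open>At a one preceded by at least \<open>n\<close> ones the approximation agrees with
  \<open>A\<close> on bit \<open>n\<close>, and the output itself reveals such a stage.\<close>

lemma turing_le_of_follow: "turing_le A (follow A)"
proof -
  let ?\<O> = "{\<lambda>n. of_bool (follow A n)} :: (nat \<Rightarrow> nat) set"
  have R: "decidable_in ?\<O> (follow A)" unfolding decidable_in_def by (rule recursive_in_oracle) simp
  have ex: "\<exists>s. follow A s \<and> n \<le> ones (follow A) s" for n
    using ones_unbounded[of "follow A"] infinitely_many_ones_follow by blast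
  have "A n = a (LEAST s. follow A s \<and> n \<le> ones (follow A) s) n" for n
  proof -
    have "A n = a s n" if "follow A s \<and> n \<le> ones (follow A) s" for s
      using that by (simp add: follow_def agreement_eq_ones)
    from this[OF LeastI_ex[OF ex[of n]]] show ?thesis .
  qed
  moreover have "decidable_in ?\<O> (\<lambda>n. a (LEAST s. follow A s \<and> n \<le> ones (follow A) s) n)"
    by (intro decidable_in_comp2[OF decidable_in_mono[OF decidable_approximation]]
        recursive_intros decidable_in_comp[OF R] ex)
  ultimately show ?thesis by (simp add: turing_le_def decidable_in_def recursive_in_def)
qed

text \<open>Isolation would make \<open>{follow A}\<close> effectively closed, and with it the
  preimage \<open>{A}\<close>, against the randomness of \<open>A\<close>.\<close>

lemma not_isolated_in_Pi01_class:
  assumes "martin_loef_random lebesgue_cantor A" "Pi01_class P"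
  shows "\<not> follow A isolated_in P"
proof
  assume "follow A isolated_in P"
  then obtain n where n: "P \<inter> cylinder (initial_segment (follow A) n) = {follow A}"
    unfolding isolated_in_iff_cylinder by blast
  have "Pi01_class {follow A}"
    using Pi01_class_inter_cylinder[OF assms(2)] n by metis
  then have "Pi01_class (follow -` {follow A})" by (rule Pi01_class_vimage)
  moreover have "follow -` {follow A} = {A}" by (auto simp: follow_eq_iff)
  ultimately show False using Pi01_singleton_not_random assms(1) by metis
qed

end

section \<open>Cantor-Bendixson ranks zero and one\<close>

lemma less_one_omega1: "\<beta> < (1 :: omega1) \<longleftrightarrow> \<beta> = 0"
  using zero_le_omega1 by (auto simp: one_omega1_def less_osuc_iff intro: antisym)

lemma cb_rank_in_isolated:
  assumes "X isolated_in P"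
  shows "cb_rank_in P X = Some 0"
proof -
  have "X \<in> iter_derivative 0 P - iter_derivative (osuc 0) P"
    using assms by (auto simp: iter_derivative_0 iter_derivative_osuc derivative_def isolated_in_def)
  then show ?thesis
    unfolding cb_rank_in_def by (auto intro!: Least_equality zero_le_omega1)
qed

lemma isolated_if_cb_rank_in_0:
  assumes "cb_rank_in P X = Some 0"
  shows "X isolated_in P"
proof -
  let ?Q = "\<lambda>\<beta>. X \<in> iter_derivative \<beta> P - iter_derivative (osuc \<beta>) P"
  from assms have "\<exists>\<beta>. ?Q \<beta>" "(LEAST \<beta>. ?Q \<beta>) = 0"
    unfolding cb_rank_in_def by (auto split: if_splits)
  with LeastI_ex[of ?Q] have "?Q 0" by metis
  then show ?thesis by (auto simp: iter_derivative_0 iter_derivative_osuc derivative_def)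
qed

text \<open>\<open>X\<close> survives the first derivative and is isolated in what remains.\<close>

lemma cb_rank_in_derivative_singleton:
  assumes "derivative P = {X}"
  shows "cb_rank_in P X = Some 1"
proof -
  let ?Q = "\<lambda>\<beta>. X \<in> iter_derivative \<beta> P - iter_derivative (osuc \<beta>) P"
  have iter1: "iter_derivative 1 P = {X}"
    by (simp add: one_omega1_def iter_derivative_osuc iter_derivative_0 assms)
  have "X isolated_in {X}" unfolding isolated_in_def by (auto intro: open_UNIV)
  then have "?Q 1" by (simp add: iter1 iter_derivative_osuc derivative_def)
  moreover have "\<not> ?Q 0" by (simp add: iter_derivative_osuc iter_derivative_0 assms)
  then have "1 \<le> \<beta>" if "?Q \<beta>" for \<beta>
    using that less_one_omega1 by (metis not_le)
  ultimately have "(LEAST \<beta>. ?Q \<beta>) = 1" by (intro Least_equality)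
  with \<open>?Q 1\<close> show ?thesis unfolding cb_rank_in_def by auto
qed

lemma cb_rank_isolated:
  assumes "Pi01_class P" "X isolated_in P"
  shows "cb_rank X = Some 0"
proof -
  have P: "Pi01_class P \<and> X \<in> P \<and> cb_rank_in P X = Some 0"
    using assms cb_rank_in_isolated by (simp add: isolated_in_def)
  then have "ranked X" unfolding ranked_def by force
  moreover have "(LEAST \<beta>. \<exists>P. Pi01_class P \<and> X \<in> P \<and> cb_rank_in P X = Some \<beta>) = 0"
    using P by (intro Least_equality zero_le_omega1) blast
  ultimately show ?thesis by (simp add: cb_rank_def)
qed

text \<open>The class \<open>P\<close> bounds the rank by one; rank zero in a class would mean
  isolation there.\<close>

lemma cb_rank_derivative_singleton:
  assumes P: "Pi01_class P" "derivative P = {X}" and "\<And>Q. Pi01_class Q \<Longrightarrow> \<not> X isolated_in Q"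
  shows "cb_rank X = Some 1"
proof -
  have P': "Pi01_class P \<and> X \<in> P \<and> cb_rank_in P X = Some 1"
    using P cb_rank_in_derivative_singleton[OF P(2)] by (auto simp: derivative_def)
  then have "ranked X" unfolding ranked_def by force
  moreover have "(LEAST \<beta>. \<exists>P. Pi01_class P \<and> X \<in> P \<and> cb_rank_in P X = Some \<beta>) = 1"
  proof (rule Least_equality)
    fix \<beta> assume "\<exists>P. Pi01_class P \<and> X \<in> P \<and> cb_rank_in P X = Some \<beta>"
    then have "\<beta> \<noteq> 0" using assms(3) isolated_if_cb_rank_in_0 by blast
    then show "1 \<le> \<beta>" using less_one_omega1 by (metis not_le)
  qed (use P' in blast)
  ultimately show ?thesis by (simp add: cb_rank_def)
qed

text \<open>All points of \<open>P\<close> other than \<open>X\<close> are isolated, so they have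
  rank zero both in \<open>P\<close> and absolutely.\<close>

lemma rank_faithful_derivative_singleton:
  assumes "Pi01_class P" "derivative P = {X}" "\<And>Q. Pi01_class Q \<Longrightarrow> \<not> X isolated_in Q"
  shows "rank_faithful P"
  unfolding rank_faithful_def
proof (intro conjI ballI impI)
  fix Y assume "Y \<in> P"
  show "cb_rank Y = cb_rank_in P Y"
  proof (cases "Y = X")
    case True
    then show ?thesis
      using cb_rank_derivative_singleton[OF assms] cb_rank_in_derivative_singleton[OF assms(2)] by simp
  next
    case False
    with \<open>Y \<in> P\<close> assms(2) have "Y isolated_in P" unfolding derivative_def by blast
    then show ?thesis using cb_rank_isolated[OF assms(1)] cb_rank_in_isolated by simp
  qed
qed (rule assms(1))

section \<open>Rank-one sequences in limit computable random degrees\<close>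

theorem theorem3p1:
  fixes r :: "cantor set"
  assumes "Delta02_random_degree r"
  shows "\<exists>(\<mu> :: cantor measure) R.
    probability_measure \<mu> \<and> computable_measure \<mu> \<and> countably_supported \<mu> \<and> R \<in> r \<and>
    martin_loef_random \<mu> R \<and>
    cb_rank R = Some 1 \<and>
    rank_faithful (measure_support \<mu>)"
proof -
  from assms obtain X where r: "r = turing_equiv `` {X}"
    unfolding Delta02_random_degree_def turing_degrees_def by (auto elim!: quotientE)
  from assms obtain Y A where Y: "Y \<in> r" "Delta02 Y"
    and A: "A \<in> r" "martin_loef_random lebesgue_cantor A"
    unfolding Delta02_random_degree_def by blast
  \<comment> \<open>The random member \<open>A\<close> and the \<open>Delta02\<close> member
    \<open>Y\<close> are obtained separately; computability from \<open>Y\<close> makes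
    \<open>A\<close> limit computable.\<close>
  have "turing_le A Y"
    using Y(1) A(1) unfolding r turing_equiv_def by (auto intro: turing_le_trans)
  from turing_le_Delta02_limit[OF this Y(2)] obtain G
    where G: "decidable_in {} (\<lambda>p. G (pfst p) (psnd p))"
      and lim: "\<And>n. \<forall>\<^sub>F s in sequentially. G n s = A n"
    by blast
  \<comment> \<open>\<open>G\<close> takes the bit first, whereas the locale expects the stage
    first.\<close>
  interpret limit_approximation "\<lambda>s i. G i s" A
    by standard (intro decidable_in_comp2[OF G] recursive_intros lim)+
  have "follow A \<in> r"
    using A(1) turing_le_follow turing_le_of_follow
    unfolding r turing_equiv_def by (auto intro: turing_le_trans)
  moreover note probability_measure_pushforward computable_measure_pushforward
    countably_supported_pushforward[OF countable_range_follow]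
    martin_loef_random_pushforward[OF A(2)]
    cb_rank_derivative_singleton[OF Pi01_class_support derivative_support
      not_isolated_in_Pi01_class[OF A(2)]]
    rank_faithful_derivative_singleton[OF Pi01_class_support derivative_support
      not_isolated_in_Pi01_class[OF A(2)]]
  ultimately show ?thesis by blast
qed

end
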